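(* Let $(M,g,(V_i)_{i\in\mathbb{Z}_r^s})$ be a Witt pseudo-Riemannian manifold. Then there exists a unique Witt connection $\nabla$ on $TM$ (called the canonical Witt connection) whose torsion $T$ is given, for all $i,j\in\mathbb{Z}_r^s$, $X_i\in\Gamma(V_i)$, $Y_j\in\Gamma(V_j)$, by $$T(X_i,Y_j)=-[X_i,Y_j]_{V_{i^*j^*}^{\perp}}+\mathcal{T}_j(X_i,Y_j)-\mathcal{T}_i(Y_j,X_i).$$
   Context: **Witt structures.** $(M,g)$ is a smooth pseudo-Riemannian manifold ($g$ a non-degenerate symmetric $(0,2)$-tensor field). Let $r,s\geq 1$ be integers, let $q_1,\dots,q_r$ be negative integers and $p_1,p_1^*,\dots,p_s,p_s^*$ non-negative integers, all distinct; put $\mathbb{Z}_r=\{q_1,\dots,q_r\}$, $\mathbb{Z}^s=\{p_1,p_1^*,\dots,p_s,p_s^*\}$, $\mathbb{Z}_r^s=\mathbb{Z}_r\cup\mathbb{Z}^s$. A Witt structure on $TM$ is a family of subbundles $(V_i)_{i\in\mathbb{Z}_r^s}$ of $TM$ such that: (i) $TM=(V_{p_s}\oplus V_{p_s^*})\oplus\cdots\oplus(V_{p_1}\oplus V_{p_1^*})\oplus V_{q_1}\oplus\cdots\oplus V_{q_r}$, where the blocks $V_{p_k}\oplus V_{p_k^*}$ $(1\le k\le s)$ and $V_{q_l}$ $(1\le l\le r)$ are mutually $g$-orthogonal; (ii) for each $k$, $V_{p_k}$ and $V_{p_k^*}$ have the same rank, are totally isotropic for $g$, and $g|_{V_{p_k}\times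 V_{p_k^*}}$ is non-degenerate; (iii) each $V_{q_l}$ is anisotropic for $g$ (no nonzero null vectors). A Witt pseudo-Riemannian manifold is a pseudo-Riemannian manifold with a Witt structure. **Notation.** $i^*=q_l$ if $i=q_l$; $i^*=p_k^*$ if $i=p_k$; $i^*=p_k$ if $i=p_k^*$. $\pi^k$ is the projection of $TM$ onto $V_k$ and $X_k=\pi^k(X)$. $V_{i^*j^*}^{\perp}=(V_{i^*}+V_{j^*})^{\perp}=\bigoplus_{k\neq i,\,k\ne j}V_k$, and $[X,Y]_{V_{i^*j^*}^\perp}=\sum_{k\ne i,j}[X,Y]_k$. $\flat,\sharp$ are the musical isomorphisms of $g$, $\alpha^\sharp_k=\pi^k(\alpha^\sharp)$ for a 1-form $\alpha$, and $\mathcal{L}$ is the Lie derivative. The tensor $\mathcal{T}_k:TM\otimes TM\to V_k$ is defined, for $X_i\in\Gamma(V_i)$, $Y_j\in\Gamma(V_j)$, by: - $\mathcal{T}_k(X_i,Y_j)=0$ if $i=j$; - $\mathcal{T}_k(X_i,Y_j)=\frac12\big((\mathcal{L}_{X_i}Y_j^\flat+\mathcal{L}_{Y_j}X_i^\flat)^\sharp_k-[X_i,Y_j]_k-(d(g(X_i,Y_j)))^\sharp_k\big)$ if $i\neq j=k$ and $i=j^*$ ($j\in\mathbb{Z}^s$); - $\mathcal{T}_k(X_i,Y_j)=\frac12\big((\mathcal{L}_{X_i}Y_j^\flat)^\sharp_k-[X_i,Y_j]_k\big)$ if $i\neq j=k$ and $i\neq j^*$; - $\mathcal{T}_k(X_i,Y_j)=0$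 if $i\neq j$ and $j\neq k$. A Witt connection is an affine connection $\nabla$ on $TM$ with $\nabla g=0$ and $\nabla(\Gamma(V_i))\subset\Gamma(V_i)$ (i.e. $\nabla_XY\in\Gamma(V_i)$ for $X\in\Gamma(TM)$, $Y\in\Gamma(V_i)$) for every $i\in\mathbb{Z}_r^s$. Torsion: $T(X,Y)=\nabla_XY-\nabla_YX-[X,Y]$. *)

theory Defs
  imports "HOL-Analysis.Analysis" "HOL-Library.Function_Algebras" "HOL-Library.FuncSet"
begin

text \<open>Pointwise scalar multiplication, so that \<^const>\<open>span\<close> and \<^const>\<open>independent\<close> apply to
  tangent vectors, which are encoded below as functionals on functions.\<close>

instantiation "fun" :: (type, real_vector) real_vector
begin

definition scaleR_fun :: "real \<Rightarrow> ('a \<Rightarrow> 'b) \<Rightarrow> 'a \<Rightarrow> 'b"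
  where "scaleR_fun c f = (\<lambda>x. c *\<^sub>R f x)"

instance
  by standard (simp_all add: scaleR_fun_def fun_eq_iff scaleR_add_right scaleR_add_left)

end


section \<open>Smooth manifolds\<close>

text \<open>\<open>C\<^sup>k\<close> maps on an open set \<open>S\<close>.\<close>

primrec Ck_on :: "nat \<Rightarrow> 'a::real_normed_vector set \<Rightarrow> ('a \<Rightarrow> 'b::real_normed_vector) \<Rightarrow> bool"
  where
    "Ck_on 0 S f \<longleftrightarrow> continuous_on S f"
  | "Ck_on (Suc k) S f \<longleftrightarrow>
       (\<forall>x\<in>S. f differentiable (at x)) \<and> (\<forall>v. Ck_on k S (\<lambda>x. frechet_derivative f (at x) v))"

definition smooth_on :: "'a::real_normed_vector set \<Rightarrow> ('a \<Rightarrow> 'b::real_normed_vector) \<Rightarrow> bool"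
  where "smooth_on S f \<longleftrightarrow> (\<forall>k. Ck_on k S f)"

text \<open>The points of the manifold are the elements of the type \<open>'m\<close>; its topology is that of the
  type. A chart is a pair of an open domain and a coordinate map into \<open>'e\<close>.\<close>

type_synonym ('m, 'e) atlas = "('m set \<times> ('m \<Rightarrow> 'e)) set"

definition smooth_manifold ::
    "('m::{t2_space,second_countable_topology}, 'e::euclidean_space) atlas \<Rightarrow> bool"
  where "smooth_manifold A \<longleftrightarrow>
    (\<forall>(U, \<phi>)\<in>A. open U \<and> open (\<phi> ` U) \<and> homeomorphism U (\<phi> ` U) \<phi> (inv_into U \<phi>)) \<and>
    (\<Union>(U, \<phi>)\<in>A. U) = UNIV \<and>
    (\<forall>(U, \<phi>)\<in>A. \<forall>(U', \<phi>')\<in>A. smooth_on (\<phi> ` (U \<inter> U')) (\<phi>' \<circ> inv_into U \<phi>))"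

definition smooth_fun_on ::
    "('m::topological_space, 'e::euclidean_space) atlas \<Rightarrow> 'm set \<Rightarrow> ('m \<Rightarrow> real) \<Rightarrow> bool"
  where "smooth_fun_on A W f \<longleftrightarrow> (\<forall>(U, \<phi>)\<in>A. smooth_on (\<phi> ` (U \<inter> W)) (f \<circ> inv_into U \<phi>))"

definition smooth_funs :: "('m::topological_space, 'e::euclidean_space) atlas \<Rightarrow> ('m \<Rightarrow> real) set"
  where "smooth_funs A = {f. smooth_fun_on A UNIV f}"


section \<open>Tangent vectors, vector fields and 1-forms\<close>

text \<open>Tangent vectors at \<open>x\<close> are the derivations at \<open>x\<close> of the algebra of smooth functions. As HOL
  functions are total, a derivation is required to vanish on functions that are not smooth.\<close>

type_synonym 'm tangent = "('m \<Rightarrow> real) \<Rightarrow> real"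

definition tangent_space ::
    "('m::topological_space, 'e::euclidean_space) atlas \<Rightarrow> 'm \<Rightarrow> 'm tangent set"
  where "tangent_space A x = {v.
    (\<forall>f\<in>smooth_funs A. \<forall>h\<in>smooth_funs A. v (f + h) = v f + v h) \<and>
    (\<forall>c. \<forall>f\<in>smooth_funs A. v (c *\<^sub>R f) = c * v f) \<and>
    (\<forall>f\<in>smooth_funs A. \<forall>h\<in>smooth_funs A. v (f * h) = f x * v h + h x * v f) \<and>
    (\<forall>f. f \<notin> smooth_funs A \<longrightarrow> v f = 0)}"

type_synonym 'm field = "'m \<Rightarrow> 'm tangent"

definition dir_deriv :: "'m field \<Rightarrow> ('m \<Rightarrow> real) \<Rightarrow> 'm \<Rightarrow> real"
  where "dir_deriv X f = (\<lambda>x. X x f)"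

definition smooth_field_on ::
    "('m::topological_space, 'e::euclidean_space) atlas \<Rightarrow> 'm set \<Rightarrow> 'm field \<Rightarrow> bool"
  where "smooth_field_on A W X \<longleftrightarrow>
    (\<forall>x\<in>W. X x \<in> tangent_space A x) \<and> (\<forall>f\<in>smooth_funs A. smooth_fun_on A W (dir_deriv X f))"

definition vector_fields :: "('m::topological_space, 'e::euclidean_space) atlas \<Rightarrow> 'm field set"
  where "vector_fields A = {X. smooth_field_on A UNIV X}"

definition mult_field :: "('m \<Rightarrow> real) \<Rightarrow> 'm field \<Rightarrow> 'm field"
  where "mult_field f X = (\<lambda>x. f x *\<^sub>R X x)"

definition lie_bracket :: "'m field \<Rightarrow> 'm field \<Rightarrow> 'm field"
  where "lie_bracket X Y = (\<lambda>x f. X x (dir_deriv Y f) - Y x (dir_deriv X f))"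

text \<open>A 1-form is represented by the functional linear over the smooth functions that it induces
  on vector fields.\<close>

type_synonym 'm one_form = "'m field \<Rightarrow> 'm \<Rightarrow> real"

definition differential :: "('m \<Rightarrow> real) \<Rightarrow> 'm one_form"
  where "differential f = (\<lambda>Z. dir_deriv Z f)"

definition lie_derivative :: "'m field \<Rightarrow> 'm one_form \<Rightarrow> 'm one_form"
  where "lie_derivative X \<alpha> = (\<lambda>Z. dir_deriv X (\<alpha> Z) - \<alpha> (lie_bracket X Z))"


section \<open>Subbundles, metrics and connections\<close>

text \<open>A subbundle of \<open>TM\<close> of constant rank \<open>n\<close>, given by its fibres and by local smooth frames.\<close>

definition subbundle ::
    "('m::topological_space, 'e::euclidean_space) atlas \<Rightarrow> nat \<Rightarrow> ('m \<Rightarrow> 'm tangent set) \<Rightarrow> bool"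
  where "subbundle A n V \<longleftrightarrow>
    (\<forall>x. \<exists>W E. open W \<and> x \<in> W \<and> (\<forall>a<n. smooth_field_on A W (E a)) \<and>
      (\<forall>y\<in>W. inj_on (\<lambda>a. E a y) {..<n} \<and> independent ((\<lambda>a. E a y) ` {..<n}) \<and>
        span ((\<lambda>a. E a y) ` {..<n}) = V y))"

definition sections ::
    "('m::topological_space, 'e::euclidean_space) atlas \<Rightarrow> ('m \<Rightarrow> 'm tangent set) \<Rightarrow> 'm field set"
  where "sections A V = {X \<in> vector_fields A. \<forall>x. X x \<in> V x}"

type_synonym 'm metric = "'m \<Rightarrow> 'm tangent \<Rightarrow> 'm tangent \<Rightarrow> real"

definition metric_fun :: "'m metric \<Rightarrow> 'm field \<Rightarrow> 'm field \<Rightarrow> 'm \<Rightarrow> real"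
  where "metric_fun g X Y = (\<lambda>x. g x (X x) (Y x))"

definition pseudo_riemannian_metric ::
    "('m::topological_space, 'e::euclidean_space) atlas \<Rightarrow> 'm metric \<Rightarrow> bool"
  where "pseudo_riemannian_metric A g \<longleftrightarrow>
    (\<forall>x. \<forall>u\<in>tangent_space A x. \<forall>v\<in>tangent_space A x. \<forall>w\<in>tangent_space A x. \<forall>a b.
       g x (a *\<^sub>R u + b *\<^sub>R v) w = a * g x u w + b * g x v w) \<and>
    (\<forall>x. \<forall>v\<in>tangent_space A x. \<forall>w\<in>tangent_space A x. g x v w = g x w v) \<and>
    (\<forall>x. \<forall>v\<in>tangent_space A x. (\<forall>w\<in>tangent_space A x. g x v w = 0) \<longrightarrow> v = 0) \<and>
    (\<forall>X\<in>vector_fields A. \<forall>Y\<in>vector_fields A. metric_fun g X Y \<in> smooth_funs A)"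

definition flat :: "'m metric \<Rightarrow> 'm field \<Rightarrow> 'm one_form"
  where "flat g Y = (\<lambda>Z. metric_fun g Y Z)"

definition sharp ::
    "('m::topological_space, 'e::euclidean_space) atlas \<Rightarrow> 'm metric \<Rightarrow> 'm one_form \<Rightarrow> 'm field"
  where "sharp A g \<alpha> =
    (THE W. W \<in> vector_fields A \<and> (\<forall>Z\<in>vector_fields A. metric_fun g W Z = \<alpha> Z))"

text \<open>Extensionality outside the smooth vector fields makes uniqueness of a connection meaningful
  as equality of HOL functions.\<close>

definition affine_connection ::
    "('m::topological_space, 'e::euclidean_space) atlas \<Rightarrow> ('m field \<Rightarrow> 'm field \<Rightarrow> 'm field) \<Rightarrow> bool"
  where "affine_connection A D \<longleftrightarrow>
    D \<in> vector_fields A \<rightarrow>\<^sub>E vector_fields A \<rightarrow>\<^sub>E vector_fields A \<and>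
    (\<forall>X\<in>vector_fields A. \<forall>Y\<in>vector_fields A. \<forall>Z\<in>vector_fields A.
       D (X + Y) Z = D X Z + D Y Z \<and> D X (Y + Z) = D X Y + D X Z) \<and>
    (\<forall>f\<in>smooth_funs A. \<forall>X\<in>vector_fields A. \<forall>Y\<in>vector_fields A.
       D (mult_field f X) Y = mult_field f (D X Y) \<and>
       D X (mult_field f Y) = mult_field (dir_deriv X f) Y + mult_field f (D X Y))"

definition metric_connection ::
    "('m::topological_space, 'e::euclidean_space) atlas \<Rightarrow> 'm metric
      \<Rightarrow> ('m field \<Rightarrow> 'm field \<Rightarrow> 'm field) \<Rightarrow> bool"
  where "metric_connection A g D \<longleftrightarrow>
    (\<forall>X\<in>vector_fields A. \<forall>Y\<in>vector_fields A. \<forall>Z\<in>vector_fields A.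
       dir_deriv X (metric_fun g Y Z) = metric_fun g (D X Y) Z + metric_fun g Y (D X Z))"

definition torsion ::
    "('m field \<Rightarrow> 'm field \<Rightarrow> 'm field) \<Rightarrow> 'm field \<Rightarrow> 'm field \<Rightarrow> 'm field"
  where "torsion D X Y = D X Y - D Y X - lie_bracket X Y"


section \<open>Witt structures\<close>

text \<open>The labels \<open>q\<^sub>l\<close> are \<open>q l\<close> for \<open>l \<in> {1..r}\<close>; the labels \<open>p\<^sub>k\<close> and \<open>p\<^sub>k\<^sup>*\<close> are \<open>p k\<close> and \<open>p' k\<close>
  for \<open>k \<in> {1..s}\<close>.\<close>

definition witt_labels ::
    "nat \<Rightarrow> nat \<Rightarrow> (nat \<Rightarrow> int) \<Rightarrow> (nat \<Rightarrow> int) \<Rightarrow> (nat \<Rightarrow> int) \<Rightarrow> bool"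
  where "witt_labels r s q p p' \<longleftrightarrow> 1 \<le> r \<and> 1 \<le> s \<and>
    (\<forall>l\<in>{1..r}. q l < 0) \<and> (\<forall>k\<in>{1..s}. 0 \<le> p k \<and> 0 \<le> p' k) \<and>
    distinct (map q [1..<Suc r] @ map p [1..<Suc s] @ map p' [1..<Suc s])"

definition witt_index_set ::
    "nat \<Rightarrow> nat \<Rightarrow> (nat \<Rightarrow> int) \<Rightarrow> (nat \<Rightarrow> int) \<Rightarrow> (nat \<Rightarrow> int) \<Rightarrow> int set"
  where "witt_index_set r s q p p' = q ` {1..r} \<union> (p ` {1..s} \<union> p' ` {1..s})"

definition witt_dual :: "nat \<Rightarrow> (nat \<Rightarrow> int) \<Rightarrow> (nat \<Rightarrow> int) \<Rightarrow> int \<Rightarrow> int"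
  where "witt_dual s p p' i =
    (if i \<in> p ` {1..s} then p' (the_inv_into {1..s} p i)
     else if i \<in> p' ` {1..s} then p (the_inv_into {1..s} p' i)
     else i)"

text \<open>The index sets of the mutually orthogonal blocks.\<close>

definition witt_blocks ::
    "nat \<Rightarrow> nat \<Rightarrow> (nat \<Rightarrow> int) \<Rightarrow> (nat \<Rightarrow> int) \<Rightarrow> (nat \<Rightarrow> int) \<Rightarrow> int set set"
  where "witt_blocks r s q p p' = (\<lambda>k. {p k, p' k}) ` {1..s} \<union> (\<lambda>l. {q l}) ` {1..r}"

text \<open>The components of \<open>v\<close> with respect to the subspaces \<open>F i\<close>, \<open>i \<in> I\<close>.\<close>

definition is_decomp :: "int set \<Rightarrow> (int \<Rightarrow> 'v set) \<Rightarrow> 'v \<Rightarrow> (int \<Rightarrow> 'v::real_vector) \<Rightarrow> bool"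
  where "is_decomp I F v u \<longleftrightarrow> (\<forall>i\<in>I. u i \<in> F i) \<and> (\<forall>i. i \<notin> I \<longrightarrow> u i = 0) \<and> v = (\<Sum>i\<in>I. u i)"

definition witt_structure ::
    "('m::topological_space, 'e::euclidean_space) atlas \<Rightarrow> 'm metric \<Rightarrow> nat \<Rightarrow> nat \<Rightarrow>
      (nat \<Rightarrow> int) \<Rightarrow> (nat \<Rightarrow> int) \<Rightarrow> (nat \<Rightarrow> int) \<Rightarrow> (int \<Rightarrow> 'm \<Rightarrow> 'm tangent set) \<Rightarrow> bool"
  where "witt_structure A g r s q p p' V \<longleftrightarrow>
    witt_labels r s q p p' \<and>
    (\<forall>i\<in>witt_index_set r s q p p'. \<exists>n. subbundle A n (V i)) \<and>
    (\<forall>x. \<forall>v\<in>tangent_space A x. \<exists>!u. is_decomp (witt_index_set r s q p p') (\<lambda>i. V i x) v u) \<and>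
    (\<forall>B\<in>witt_blocks r s q p p'. \<forall>B'\<in>witt_blocks r s q p p'. B \<noteq> B' \<longrightarrow>
       (\<forall>i\<in>B. \<forall>j\<in>B'. \<forall>x. \<forall>v\<in>V i x. \<forall>w\<in>V j x. g x v w = 0)) \<and>
    (\<forall>k\<in>{1..s}.
       (\<exists>n. subbundle A n (V (p k)) \<and> subbundle A n (V (p' k))) \<and>
       (\<forall>x. \<forall>v\<in>V (p k) x. \<forall>w\<in>V (p k) x. g x v w = 0) \<and>
       (\<forall>x. \<forall>v\<in>V (p' k) x. \<forall>w\<in>V (p' k) x. g x v w = 0) \<and>
       (\<forall>x. \<forall>v\<in>V (p k) x. (\<forall>w\<in>V (p' k) x. g x v w = 0) \<longrightarrow> v = 0) \<and>
       (\<forall>x. \<forall>w\<in>V (p' k) x. (\<forall>v\<in>V (p k) x. g x v w = 0) \<longrightarrow> w = 0)) \<and>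
    (\<forall>l\<in>{1..r}. \<forall>x. \<forall>v\<in>V (q l) x. g x v v = 0 \<longrightarrow> v = 0)"

text \<open>In the following, \<open>I\<close> is the index set and \<open>d\<close> the involution \<open>i \<mapsto> i\<^sup>*\<close>.\<close>

definition proj :: "int set \<Rightarrow> (int \<Rightarrow> 'm \<Rightarrow> 'm tangent set) \<Rightarrow> int \<Rightarrow> 'm field \<Rightarrow> 'm field"
  where "proj I V k X = (\<lambda>x. (THE u. is_decomp I (\<lambda>i. V i x) (X x) u) k)"

definition proj_perp ::
    "int set \<Rightarrow> (int \<Rightarrow> 'm \<Rightarrow> 'm tangent set) \<Rightarrow> int \<Rightarrow> int \<Rightarrow> 'm field \<Rightarrow> 'm field"
  where "proj_perp I V i j X = (\<Sum>k\<in>I - {i, j}. proj I V k X)"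

text \<open>The value of \<open>\<T>\<^sub>k\<close> on a section \<open>X\<close> of \<open>V\<^sub>i\<close> and a section \<open>Y\<close> of \<open>V\<^sub>j\<close>.\<close>

definition witt_tensor_hom ::
    "('m::topological_space, 'e::euclidean_space) atlas \<Rightarrow> 'm metric \<Rightarrow> int set \<Rightarrow> (int \<Rightarrow> int) \<Rightarrow>
      (int \<Rightarrow> 'm \<Rightarrow> 'm tangent set) \<Rightarrow> int \<Rightarrow> int \<Rightarrow> int \<Rightarrow> 'm field \<Rightarrow> 'm field \<Rightarrow> 'm field"
  where "witt_tensor_hom A g I d V k i j X Y =
    (if i = j \<or> j \<noteq> k then 0
     else if i = d j then
       (1/2) *\<^sub>R (proj I V k (sharp A g (lie_derivative X (flat g Y) + lie_derivative Y (flat g X)))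
                - proj I V k (lie_bracket X Y)
                - proj I V k (sharp A g (differential (metric_fun g X Y))))
     else
       (1/2) *\<^sub>R (proj I V k (sharp A g (lie_derivative X (flat g Y)))
                - proj I V k (lie_bracket X Y)))"

text \<open>\<open>\<T>\<^sub>k\<close> on arbitrary vector fields, by biadditivity.\<close>

definition witt_tensor ::
    "('m::topological_space, 'e::euclidean_space) atlas \<Rightarrow> 'm metric \<Rightarrow> int set \<Rightarrow> (int \<Rightarrow> int) \<Rightarrow>
      (int \<Rightarrow> 'm \<Rightarrow> 'm tangent set) \<Rightarrow> int \<Rightarrow> 'm field \<Rightarrow> 'm field \<Rightarrow> 'm field"
  where "witt_tensor A g I d V k X Y =
    (\<Sum>i\<in>I. \<Sum>j\<in>I. witt_tensor_hom A g I d V k i j (proj I V i X) (proj I V j Y))"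

definition witt_connection ::
    "('m::topological_space, 'e::euclidean_space) atlas \<Rightarrow> 'm metric \<Rightarrow> int set \<Rightarrow>
      (int \<Rightarrow> 'm \<Rightarrow> 'm tangent set) \<Rightarrow> ('m field \<Rightarrow> 'm field \<Rightarrow> 'm field) \<Rightarrow> bool"
  where "witt_connection A g I V D \<longleftrightarrow>
    affine_connection A D \<and> metric_connection A g D \<and>
    (\<forall>i\<in>I. \<forall>X\<in>vector_fields A. \<forall>Y\<in>sections A (V i). D X Y \<in> sections A (V i))"

end

theory Submission
  imports Defs
begin

text \<open>
  Write \<open>X\<^sub>i\<close> for the component of \<open>X\<close> in \<open>V i\<close> and \<open>d i\<close> for the dual index \<open>i\<^sup>*\<close>. Uniqueness is the classical
  fact that a metric connection is determined by its torsion (\<open>metric_connection_unique\<close>); the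
  torsion is prescribed on sections of the \<open>V i\<close>, hence everywhere by additivity.

  For existence, compare components. A connection that preserves every \<open>V i\<close> has the prescribed
  torsion if and only if for \<open>i \<noteq> j\<close> the derivative of \<open>Y\<^sub>j\<close> along \<open>X\<^sub>i\<close> is
  \<open>[X\<^sub>i, Y\<^sub>j]\<^sub>j + T\<^sub>j(X\<^sub>i, Y\<^sub>j)\<close>, and for \<open>i = j\<close> the torsion has no component in \<open>V i\<close>. For
  \<open>i = d j\<close> the value just given is the component in \<open>V j\<close> of the Levi-Civita derivative, and for
  \<open>i \<noteq> j\<close>, \<open>i \<noteq> d j\<close> it is that component plus half of the vector representing
  \<open>Z \<mapsto> g([Y\<^sub>j, Z\<^bsub>d j\<^esub>], X\<^sub>i)\<close>. The Levi-Civita component also works for \<open>i = j\<close>, since the Levi-Civita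
  connection is torsion-free. So the connection is defined by one formula: \<open>2 g(D X Y, Z)\<close> is the sum
  over \<open>j\<close> of the Koszul expression of \<open>X\<close>, \<open>Y\<^sub>j\<close>, \<open>Z\<^bsub>d j\<^esub>\<close> and of \<open>g([Y\<^sub>j, Z\<^bsub>d j\<^esub>], X')\<close>, where \<open>X'\<close> is the
  part of \<open>X\<close> outside \<open>V j\<close> and \<open>V (d j)\<close>. The formula is linear over the smooth functions in \<open>X\<close> and
  \<open>Z\<close>, obeys the Leibniz rule in \<open>Y\<close>, and is compatible with the metric because the Koszul expression is,
  while the correction is skew in \<open>Y\<close> and \<open>Z\<close> (\<open>conn_term_skew\<close>). The torsion is computed in
  \<open>conn_off_diagonal\<close> and \<open>conn_diagonal\<close>.

  The analytic content is that functionals linear over the smooth functions are represented by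
  smooth fields (\<open>smooth_form_represented\<close>) and that the projections preserve smoothness
  (\<open>proj_closed\<close>). Both are read off in frames. The local frames that are part of the notion of
  subbundle, multiplied by bump functions (\<open>bump_function\<close>), give global fields that form a
  basis of the tangent spaces near a given point (\<open>frame_near\<close>). Since \<open>g\<close> is
  non-degenerate the Gram matrix of such a frame is invertible, with smooth inverse by elimination (\<open>linear_system_solvable_near\<close>).
\<close>

section \<open>Calculus of \<open>C\<^sup>k\<close> maps\<close>

lemma Ck_on_SucD:
  assumes "Ck_on (Suc k) S f" "x \<in> S"
  shows "(f has_derivative frechet_derivative f (at x)) (at x)"
  using assms by (simp add: frechet_derivative_works)

lemma Ck_on_cong:
  assumes "open S" "\<And>x. x \<in> S \<Longrightarrow> f x = h x" "Ck_on k S f"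
  shows "Ck_on k S h"
  using assms(2,3)
proof (induction k arbitrary: f h)
  case 0
  then show ?case using continuous_on_cong by (metis Ck_on.simps(1))
next
  case (Suc k)
  have "f differentiable (at x) \<Longrightarrow> h differentiable (at x)" if "x \<in> S" for x
    using Suc.prems(1) that \<open>open S\<close>
    by (meson differentiable_def has_derivative_transform_within_open)
  moreover have "frechet_derivative f (at x) = frechet_derivative h (at x)"
    if "x \<in> S" "f differentiable (at x)" for x
    using frechet_derivative_transform_within_open[OF that(2) \<open>open S\<close> that(1) Suc.prems(1)] .
  ultimately show ?case
    using Suc.prems(2) Suc.IH[of "\<lambda>x. frechet_derivative f (at x) _" "\<lambda>x. frechet_derivative h (at x) _"]
    by auto
qed

text \<open>Exhibiting any family of derivatives suffices: as \<open>S\<close> is open, it agrees on \<open>S\<close> with the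
  chosen \<^const>\<open>frechet_derivative\<close>.\<close>

lemma Ck_on_SucI:
  assumes "open S" "\<And>x. x \<in> S \<Longrightarrow> (f has_derivative f' x) (at x)"
    and "\<And>v. Ck_on k S (\<lambda>x. f' x v)"
  shows "Ck_on (Suc k) S f"
proof -
  have "frechet_derivative f (at x) = f' x" if "x \<in> S" for x
    using assms(2)[OF that] frechet_derivative_at by metis
  then have "Ck_on k S (\<lambda>x. frechet_derivative f (at x) v)" for v
    by (intro Ck_on_cong[OF assms(1) _ assms(3)[of v]]) auto
  then show ?thesis
    using assms(2) by (auto simp: differentiable_def)
qed

lemma Ck_on_subset: "Ck_on k S f \<Longrightarrow> T \<subseteq> S \<Longrightarrow> Ck_on k T f"
  by (induction k arbitrary: f) (auto intro: continuous_on_subset)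

lemma Ck_on_SucD_le: "Ck_on (Suc k) S f \<Longrightarrow> Ck_on k S f"
proof (induction k arbitrary: f)
  case 0
  then show ?case
    by (auto intro!: continuous_at_imp_continuous_on differentiable_imp_continuous_within)
qed auto

lemma Ck_on_locally:
  assumes "\<And>x. x \<in> S \<Longrightarrow> \<exists>T. open T \<and> x \<in> T \<and> Ck_on k T f"
  shows "Ck_on k S f"
  using assms
proof (induction k arbitrary: f)
  case 0
  have "continuous (at x within S) f" if x: "x \<in> S" for x
  proof -
    obtain T where "open T" "x \<in> T" "continuous_on T f"
      using 0[OF x] by auto
    then show ?thesis
      using continuous_on_eq_continuous_at continuous_at_imp_continuous_at_within by blast
  qed
  then show ?case by (simp add: continuous_on_eq_continuous_within)
next
  case (Suc k)
  have "f differentiable (at x)" if "x \<in> S" for x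
    using Suc.prems[OF that] by auto
  moreover have "Ck_on k S (\<lambda>x. frechet_derivative f (at x) v)" for v
    using Suc.prems by (intro Suc.IH) fastforce
  ultimately show ?case by simp
qed

lemma Ck_on_const: "Ck_on k S (\<lambda>_. c)"
  by (induction k arbitrary: c) (simp_all add: frechet_derivative_const)

lemma Ck_on_add:
  assumes "open S" "Ck_on k S f" "Ck_on k S h"
  shows "Ck_on k S (\<lambda>x. f x + h x)"
  using assms(2,3)
proof (induction k arbitrary: f h)
  case 0
  then show ?case by (simp add: continuous_on_add)
next
  case (Suc k)
  show ?case
    by (rule Ck_on_SucI[OF \<open>open S\<close>, where
          f' = "\<lambda>x v. frechet_derivative f (at x) v + frechet_derivative h (at x) v"])
      (use Suc in \<open>auto intro!: has_derivative_add Ck_on_SucD\<close>)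
qed

lemma (in bounded_bilinear) Ck_on_prod:
  assumes "open S" "Ck_on k S f" "Ck_on k S h"
  shows "Ck_on k S (\<lambda>x. prod (f x) (h x))"
  using assms(2,3)
proof (induction k arbitrary: f h)
  case 0
  then show ?case by (simp add: continuous_on)
next
  case (Suc k)
  show ?case
  proof (rule Ck_on_SucI[OF \<open>open S\<close>])
    fix x assume "x \<in> S"
    then show "((\<lambda>x. prod (f x) (h x)) has_derivative
      (\<lambda>v. prod (f x) (frechet_derivative h (at x) v) + prod (frechet_derivative f (at x) v) (h x)))
      (at x)"
      using Suc.prems by (intro FDERIV Ck_on_SucD)
  next
    show "Ck_on k S (\<lambda>x. prod (f x) (frechet_derivative h (at x) v)
      + prod (frechet_derivative f (at x) v) (h x))" for v
      using Suc.prems by (intro Ck_on_add \<open>open S\<close> Suc.IH) (auto dest: Ck_on_SucD_le simp del: Ck_on.simps, auto)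
  qed
qed

lemmas Ck_on_mult = bounded_bilinear.Ck_on_prod[OF bounded_bilinear_mult]
lemmas Ck_on_inner = bounded_bilinear.Ck_on_prod[OF bounded_bilinear_inner]

lemma Ck_on_inverse:
  fixes f :: "'a::real_normed_vector \<Rightarrow> real"
  assumes "open S" "Ck_on k S f" "\<And>x. x \<in> S \<Longrightarrow> f x \<noteq> 0"
  shows "Ck_on k S (\<lambda>x. inverse (f x))"
  using assms(2)
proof (induction k)
  case 0
  then show ?case using assms(3) by (auto intro: continuous_on_inverse)
next
  case (Suc k)
  show ?case
  proof (rule Ck_on_SucI[OF \<open>open S\<close>])
    fix x assume "x \<in> S"
    then show "((\<lambda>x. inverse (f x)) has_derivative
      (\<lambda>v. - (inverse (f x) * frechet_derivative f (at x) v * inverse (f x)))) (at x)"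
      using Suc.prems assms(3) by (intro Deriv.has_derivative_inverse Ck_on_SucD)
  next
    fix v
    have "Ck_on k S (\<lambda>x. - 1 * (inverse (f x) * frechet_derivative f (at x) v * inverse (f x)))"
      using Suc.prems Ck_on_SucD_le[OF Suc.prems]
      by (intro Ck_on_mult Ck_on_const \<open>open S\<close> Suc.IH) auto
    then show "Ck_on k S (\<lambda>x. - (inverse (f x) * frechet_derivative f (at x) v * inverse (f x)))"
      by simp
  qed
qed

text \<open>The functions \<open>t\<^sup>-\<^sup>n exp (- 1 / t)\<close> on the positive half-line, extended by \<open>0\<close>. The whole
  family is needed and not just \<open>n = 0\<close>, because its span is closed under differentiation, so
  that smoothness follows by induction on the order for all \<open>n\<close> at once.\<close>

definition flat_exp :: "nat \<Rightarrow> real \<Rightarrow> real"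
  where "flat_exp n t = (if 0 < t then inverse t ^ n * exp (- inverse t) else 0)"

text \<open>One term of the series of \<open>exp (1 / t)\<close> is enough. The bound being quadratic in \<open>t\<close>, it gives
  the derivative \<open>0\<close> at the origin.\<close>

lemma flat_exp_le: "\<bar>flat_exp n t\<bar> \<le> fact (n + 2) * t\<^sup>2"
proof (cases "0 < t")
  case True
  define u where "u = inverse t"
  have u: "0 < u" using True by (simp add: u_def)
  have "u ^ (n + 2) / fact (n + 2) \<le> exp u"
  proof -
    have "(\<lambda>k. u ^ k /\<^sub>R fact k) sums exp u" by (rule exp_converges)
    moreover have "(\<Sum>k\<in>{n+2}. u ^ k /\<^sub>R fact k) \<le> (\<Sum>k. u ^ k /\<^sub>R fact k)"
      using calculation u by (intro sum_le_suminf) (auto simp: sums_iff)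
    ultimately have "u ^ (n + 2) /\<^sub>R fact (n + 2) \<le> exp u"
      by (simp add: sums_iff del: fact_Suc)
    then show ?thesis by (simp add: divide_inverse mult.commute)
  qed
  then have "u ^ n * exp (- u) \<le> fact (n + 2) * inverse (u\<^sup>2)"
    using u by (simp add: exp_minus divide_simps power_add power2_eq_square mult_ac)
  then show ?thesis using True by (simp add: flat_exp_def u_def power_inverse del: fact_Suc)
qed (simp add: flat_exp_def)

lemma flat_exp_deriv:
  "(flat_exp n has_real_derivative (flat_exp (n + 2) t - n * flat_exp (n + 1) t)) (at t)"
proof -
  consider "t < 0" | "t = 0" | "0 < t" by linarith
  then show ?thesis
  proof cases
    case 1
    have "((\<lambda>_. 0) has_real_derivative 0) (at t)" by simp
    then have "(flat_exp n has_real_derivative 0) (at t)"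
      by (rule DERIV_cong_ev[THEN iffD1, rotated -1])
         (use 1 in \<open>auto simp: flat_exp_def eventually_nhds intro!: exI[of _ "{..<0}"]\<close>)
    then show ?thesis using 1 by (simp add: flat_exp_def)
  next
    case 2
    have "((\<lambda>h. flat_exp n h / h) \<longlongrightarrow> 0) (at 0)"
    proof (rule Lim_null_comparison)
      show "\<forall>\<^sub>F h in at 0. norm (flat_exp n h / h) \<le> fact (n + 2) * \<bar>h\<bar>"
      proof (rule always_eventually, rule allI)
        fix h :: real
        show "norm (flat_exp n h / h) \<le> fact (n + 2) * \<bar>h\<bar>"
          using flat_exp_le[of n h]
          by (cases "h = 0") (simp_all add: divide_le_eq power2_eq_square abs_mult_self_eq mult.assoc)
      qed
      have "((\<lambda>h::real. fact (n + 2) * \<bar>h\<bar>) \<longlongrightarrow> fact (n + 2) * \<bar>0\<bar>) (at 0)"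
        by (intro tendsto_intros)
      then show "((\<lambda>h::real. fact (n + 2) * \<bar>h\<bar>) \<longlongrightarrow> 0) (at 0)" by simp
    qed
    then show ?thesis
      using 2 by (simp add: DERIV_def flat_exp_def)
  next
    case 3
    have "((\<lambda>t. inverse t ^ n * exp (- inverse t)) has_real_derivative
      (inverse t ^ (n + 2) * exp (- inverse t) - n * (inverse t ^ (n + 1) * exp (- inverse t)))) (at t)"
    proof (cases n)
      case 0
      with 3 show ?thesis
        by (auto intro!: derivative_eq_intros simp: power2_eq_square)
    next
      case (Suc m)
      with 3 show ?thesis
        by (auto intro!: derivative_eq_intros simp: algebra_simps power2_eq_square)
          (metis One_nat_def neq0_conv power_eq_if)
    qed
    then have "(flat_exp n has_real_derivative
      (inverse t ^ (n + 2) * exp (- inverse t) - n * (inverse t ^ (n + 1) * exp (- inverse t)))) (at t)"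
      by (rule DERIV_cong_ev[THEN iffD1, rotated -1])
         (use 3 in \<open>auto simp: flat_exp_def eventually_nhds intro!: exI[of _ "{0<..}"]\<close>)
    then show ?thesis using 3 by (simp add: flat_exp_def)
  qed
qed

text \<open>Only compositions with a real function \<open>\<rho>\<close> occur, so the chain rule in one variable
  replaces the one for maps between vector spaces.\<close>

lemma Ck_on_flat_exp:
  assumes "open S" "Ck_on k S \<rho>"
  shows "Ck_on k S (\<lambda>x. flat_exp n (\<rho> x))"
  using assms(2)
proof (induction k arbitrary: n)
  case 0
  have "continuous_on UNIV (flat_exp n)"
    using flat_exp_deriv by (auto intro: DERIV_isCont continuous_at_imp_continuous_on)
  then show ?case
    using 0 continuous_on_compose2[of UNIV "flat_exp n" S \<rho>] by simp
next
  case (Suc k)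
  define F where "F t = flat_exp (n + 2) t + (- real n) * flat_exp (n + 1) t" for t
  show ?case
  proof (rule Ck_on_SucI[OF \<open>open S\<close>])
    fix x assume x: "x \<in> S"
    have "(flat_exp n has_derivative (\<lambda>t. F (\<rho> x) * t)) (at (\<rho> x))"
      using flat_exp_deriv[of n "\<rho> x"] by (simp add: has_field_derivative_def F_def)
    from diff_chain_at[OF Ck_on_SucD[OF Suc.prems x] this]
    show "((\<lambda>x. flat_exp n (\<rho> x)) has_derivative
        (\<lambda>v. F (\<rho> x) * frechet_derivative \<rho> (at x) v)) (at x)"
      by (simp add: o_def)
  next
    show "Ck_on k S (\<lambda>x. F (\<rho> x) * frechet_derivative \<rho> (at x) v)" for v
      unfolding F_def using Suc.prems Ck_on_SucD_le[OF Suc.prems]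
      by (intro Ck_on_mult Ck_on_add Ck_on_const \<open>open S\<close> Suc.IH) auto
  qed
qed

section \<open>Germs of smooth functions and bump functions\<close>

text \<open>Smoothness of a germ. Global smoothness is smoothness near every point, and germs, unlike
  functions on a fixed domain, can be divided, patched and restricted without tracking domains.\<close>

definition smooth_near ::
    "('m::topological_space, 'e::euclidean_space) atlas \<Rightarrow> 'm \<Rightarrow> ('m \<Rightarrow> real) \<Rightarrow> bool"
  where "smooth_near A x f \<longleftrightarrow> (\<exists>W. open W \<and> x \<in> W \<and> smooth_fun_on A W f)"

locale smooth_mfd =
  fixes A :: "('m::{t2_space,second_countable_topology}, 'e::euclidean_space) atlas"
  assumes smooth_manifold: "smooth_manifold A"
begin

lemma chart_homeomorphism:
  "(U, \<phi>) \<in> A \<Longrightarrow> homeomorphism U (\<phi> ` U) \<phi> (inv_into U \<phi>)"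
  and chart_open: "(U, \<phi>) \<in> A \<Longrightarrow> open U"
  and chart_image_open: "(U, \<phi>) \<in> A \<Longrightarrow> open (\<phi> ` U)"
  and chart_transition: "(U, \<phi>) \<in> A \<Longrightarrow> (U', \<phi>') \<in> A \<Longrightarrow>
    smooth_on (\<phi> ` (U \<inter> U')) (\<phi>' \<circ> inv_into U \<phi>)"
  using smooth_manifold unfolding smooth_manifold_def by blast+

lemma chart_at: obtains U \<phi> where "(U, \<phi>) \<in> A" "x \<in> U"
proof -
  have "x \<in> (\<Union>(U, \<phi>)\<in>A. U)"
    using smooth_manifold unfolding smooth_manifold_def by simp
  then show ?thesis using that by auto
qed

lemma chart_inv: "(U, \<phi>) \<in> A \<Longrightarrow> y \<in> U \<Longrightarrow> inv_into U \<phi> (\<phi> y) = y"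
  using chart_homeomorphism homeomorphism_apply1 by metis

lemma chart_image_Int_open:
  assumes "(U, \<phi>) \<in> A" "open W"
  shows "open (\<phi> ` (U \<inter> W))"
proof -
  have "openin (top_of_set U) (U \<inter> W)" using assms(2) by (simp add: openin_open_Int)
  then have "openin (top_of_set (\<phi> ` U)) (\<phi> ` (U \<inter> W))"
    using homeomorphism_imp_open_map[OF chart_homeomorphism[OF assms(1)]] by blast
  then show ?thesis using openin_open_eq[OF chart_image_open[OF assms(1)]] by blast
qed

lemma smooth_fun_on_iff_Ck:
  "smooth_fun_on A W f \<longleftrightarrow>
    (\<forall>U \<phi> k. (U, \<phi>) \<in> A \<longrightarrow> Ck_on k (\<phi> ` (U \<inter> W)) (\<lambda>z. f (inv_into U \<phi> z)))"
  unfolding smooth_fun_on_def smooth_on_def by (auto simp: o_def)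

lemma smooth_fun_on_const: "smooth_fun_on A W (\<lambda>_. c)"
  by (simp add: smooth_fun_on_iff_Ck Ck_on_const)

lemma smooth_fun_on_add:
  "open W \<Longrightarrow> smooth_fun_on A W f \<Longrightarrow> smooth_fun_on A W h \<Longrightarrow> smooth_fun_on A W (\<lambda>y. f y + h y)"
  by (simp add: smooth_fun_on_iff_Ck Ck_on_add chart_image_Int_open)

lemma smooth_fun_on_mult:
  "open W \<Longrightarrow> smooth_fun_on A W f \<Longrightarrow> smooth_fun_on A W h \<Longrightarrow> smooth_fun_on A W (\<lambda>y. f y * h y)"
  by (simp add: smooth_fun_on_iff_Ck Ck_on_mult chart_image_Int_open)

lemma smooth_fun_on_inverse:
  assumes "open W" "smooth_fun_on A W f" "\<And>y. y \<in> W \<Longrightarrow> f y \<noteq> 0"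
  shows "smooth_fun_on A W (\<lambda>y. inverse (f y))"
  unfolding smooth_fun_on_iff_Ck
proof (intro allI impI)
  fix U \<phi> k assume U: "(U, \<phi>) \<in> A"
  show "Ck_on k (\<phi> ` (U \<inter> W)) (\<lambda>z. inverse (f (inv_into U \<phi> z)))"
    using assms U
    by (intro Ck_on_inverse chart_image_Int_open) (auto simp: smooth_fun_on_iff_Ck chart_inv)
qed

lemma smooth_fun_on_cong:
  assumes "open W" "\<And>y. y \<in> W \<Longrightarrow> f y = h y" "smooth_fun_on A W f"
  shows "smooth_fun_on A W h"
  unfolding smooth_fun_on_iff_Ck
proof (intro allI impI)
  fix U \<phi> k assume U: "(U, \<phi>) \<in> A"
  show "Ck_on k (\<phi> ` (U \<inter> W)) (\<lambda>z. h (inv_into U \<phi> z))"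
    by (rule Ck_on_cong[of "\<phi> ` (U \<inter> W)" "\<lambda>z. f (inv_into U \<phi> z)" "\<lambda>z. h (inv_into U \<phi> z)"])
       (use assms U chart_image_Int_open in \<open>auto simp: smooth_fun_on_iff_Ck chart_inv\<close>)
qed

lemma smooth_fun_on_subset: "smooth_fun_on A W f \<Longrightarrow> W' \<subseteq> W \<Longrightarrow> smooth_fun_on A W' f"
  unfolding smooth_fun_on_iff_Ck by (meson Ck_on_subset Int_mono image_mono order_refl)

lemma smooth_fun_on_isCont:
  assumes "open W" "y \<in> W" "smooth_fun_on A W f"
  shows "isCont f y"
proof -
  obtain U \<phi> where U: "(U, \<phi>) \<in> A" "y \<in> U" by (rule chart_at)
  have "continuous_on (\<phi> ` (U \<inter> W)) (\<lambda>z. f (inv_into U \<phi> z))"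
    using assms(3) U(1) Ck_on.simps(1) unfolding smooth_fun_on_iff_Ck by blast
  moreover have "continuous_on (U \<inter> W) \<phi>"
    using homeomorphism_cont1[OF chart_homeomorphism[OF U(1)]] by (rule continuous_on_subset) auto
  ultimately have "continuous_on (U \<inter> W) (\<lambda>y. f (inv_into U \<phi> (\<phi> y)))"
    by (rule continuous_on_compose2) auto
  then have "continuous_on (U \<inter> W) f"
    by (rule continuous_on_eq) (use U chart_inv in auto)
  then show ?thesis
    using continuous_on_eq_continuous_at[of "U \<inter> W" f] assms U chart_open by blast
qed

text \<open>Charts are homeomorphisms, so a cover of the manifold by open sets gives an open cover of each
  coordinate domain, and \<^const>\<open>Ck_on\<close> is a local condition on open sets.\<close>

lemma smooth_funs_iff: "f \<in> smooth_funs A \<longleftrightarrow> (\<forall>x. smooth_near A x f)"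
proof
  assume "f \<in> smooth_funs A"
  then show "\<forall>x. smooth_near A x f"
    unfolding smooth_near_def smooth_funs_def by auto
next
  assume *: "\<forall>x. smooth_near A x f"
  show "f \<in> smooth_funs A"
    unfolding smooth_funs_def smooth_fun_on_iff_Ck mem_Collect_eq
  proof (intro allI impI, rule Ck_on_locally)
    fix U \<phi> k z assume U: "(U, \<phi>) \<in> A" and "z \<in> \<phi> ` (U \<inter> UNIV)"
    then obtain y where y: "y \<in> U" "z = \<phi> y" by auto
    obtain W where W: "open W" "y \<in> W" "smooth_fun_on A W f"
      using * unfolding smooth_near_def by blast
    show "\<exists>T. open T \<and> z \<in> T \<and> Ck_on k T (\<lambda>z. f (inv_into U \<phi> z))"
      using W U y chart_image_Int_open[OF U W(1)] unfolding smooth_fun_on_iff_Ck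
      by (intro exI[of _ "\<phi> ` (U \<inter> W)"]) auto
  qed
qed

lemma smooth_near_cong:
  assumes "\<forall>\<^sub>F y in nhds x. f y = h y" "smooth_near A x f"
  shows "smooth_near A x h"
proof -
  obtain S where S: "open S" "x \<in> S" "\<forall>y\<in>S. f y = h y"
    using assms(1) unfolding eventually_nhds by blast
  obtain W where W: "open W" "x \<in> W" "smooth_fun_on A W f"
    using assms(2) unfolding smooth_near_def by blast
  have "smooth_fun_on A (S \<inter> W) f"
    using smooth_fun_on_subset[OF W(3)] by auto
  then have "smooth_fun_on A (S \<inter> W) h"
    using S W by (elim smooth_fun_on_cong[rotated -1]) auto
  then show ?thesis
    unfolding smooth_near_def using S W by (intro exI[of _ "S \<inter> W"]) auto
qed

lemma smooth_near_const: "smooth_near A x (\<lambda>_. c)"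
  unfolding smooth_near_def by (intro exI[of _ UNIV]) (simp add: smooth_fun_on_const)

lemma smooth_near_binop:
  assumes "\<And>W f h. open W \<Longrightarrow> smooth_fun_on A W f \<Longrightarrow> smooth_fun_on A W h \<Longrightarrow>
      smooth_fun_on A W (F f h)"
    and "smooth_near A x f" "smooth_near A x h"
  shows "smooth_near A x (F f h)"
proof -
  obtain W where W: "open W" "x \<in> W" "smooth_fun_on A W f"
    using assms(2) unfolding smooth_near_def by auto
  obtain W' where W': "open W'" "x \<in> W'" "smooth_fun_on A W' h"
    using assms(3) unfolding smooth_near_def by auto
  have "smooth_fun_on A (W \<inter> W') f" "smooth_fun_on A (W \<inter> W') h"
    using smooth_fun_on_subset[OF W(3)] smooth_fun_on_subset[OF W'(3)] by auto
  then have "smooth_fun_on A (W \<inter> W') (F f h)"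
    using W(1) W'(1) by (intro assms(1)) auto
  then show ?thesis
    unfolding smooth_near_def using W W' by (intro exI[of _ "W \<inter> W'"]) auto
qed

lemma smooth_near_add:
  "smooth_near A x f \<Longrightarrow> smooth_near A x h \<Longrightarrow> smooth_near A x (\<lambda>y. f y + h y)"
  by (rule smooth_near_binop[where F = "\<lambda>f h y. f y + h y", OF smooth_fun_on_add])

lemma smooth_near_mult:
  "smooth_near A x f \<Longrightarrow> smooth_near A x h \<Longrightarrow> smooth_near A x (\<lambda>y. f y * h y)"
  by (rule smooth_near_binop[where F = "\<lambda>f h y. f y * h y", OF smooth_fun_on_mult])

lemma smooth_near_diff:
  assumes "smooth_near A x f" "smooth_near A x h"
  shows "smooth_near A x (\<lambda>y. f y - h y)"
  using smooth_near_add[OF assms(1) smooth_near_mult[OF smooth_near_const[of x "-1"] assms(2)]]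
  by simp

lemma smooth_near_sum:
  "(\<And>a. a \<in> N \<Longrightarrow> smooth_near A x (f a)) \<Longrightarrow> smooth_near A x (\<lambda>y. \<Sum>a\<in>N. f a y)"
  by (induction N rule: infinite_finite_induct) (simp_all add: smooth_near_const smooth_near_add)

lemma smooth_near_isCont: "smooth_near A x f \<Longrightarrow> isCont f x"
  unfolding smooth_near_def using smooth_fun_on_isCont by blast

lemma smooth_near_eventually_nonzero:
  assumes "smooth_near A x f" "f x \<noteq> 0"
  shows "\<forall>\<^sub>F y in nhds x. f y \<noteq> 0"
proof -
  have "(f \<longlongrightarrow> f x) (nhds x)"
    using smooth_near_isCont[OF assms(1)] by (simp add: isCont_def tendsto_at_iff_tendsto_nhds)
  then show ?thesis using assms(2) by (rule tendsto_imp_eventually_ne)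
qed

lemma smooth_near_inverse:
  assumes "smooth_near A x f" "f x \<noteq> 0"
  shows "smooth_near A x (\<lambda>y. inverse (f y))"
proof -
  obtain S where S: "open S" "x \<in> S" "\<forall>y\<in>S. f y \<noteq> 0"
    using smooth_near_eventually_nonzero[OF assms] unfolding eventually_nhds by blast
  obtain W where W: "open W" "x \<in> W" "smooth_fun_on A W f"
    using assms(1) unfolding smooth_near_def by blast
  have "smooth_fun_on A (S \<inter> W) f"
    using smooth_fun_on_subset[OF W(3)] by auto
  then have "smooth_fun_on A (S \<inter> W) (\<lambda>y. inverse (f y))"
    using S W by (intro smooth_fun_on_inverse) auto
  then show ?thesis
    unfolding smooth_near_def using S W by (intro exI[of _ "S \<inter> W"]) auto
qed

lemma smooth_near_eventually:
  "smooth_near A x f \<Longrightarrow> \<forall>\<^sub>F y in nhds x. smooth_near A y f"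
  unfolding smooth_near_def eventually_nhds by blast

lemma smooth_funs_near: "f \<in> smooth_funs A \<Longrightarrow> smooth_near A x f"
  by (simp add: smooth_funs_iff)

lemma smooth_funs_add [simp]: "f \<in> smooth_funs A \<Longrightarrow> h \<in> smooth_funs A \<Longrightarrow> f + h \<in> smooth_funs A"
  and smooth_funs_diff [simp]: "f \<in> smooth_funs A \<Longrightarrow> h \<in> smooth_funs A \<Longrightarrow> f - h \<in> smooth_funs A"
  and smooth_funs_mult [simp]: "f \<in> smooth_funs A \<Longrightarrow> h \<in> smooth_funs A \<Longrightarrow> f * h \<in> smooth_funs A"
  and smooth_funs_const [simp]: "(\<lambda>_. c) \<in> smooth_funs A"
  by (simp_all add: smooth_funs_iff plus_fun_def times_fun_def fun_diff_def
      smooth_near_add smooth_near_diff smooth_near_mult smooth_near_const)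

lemma smooth_funs_scaleR [simp]: "f \<in> smooth_funs A \<Longrightarrow> c *\<^sub>R f \<in> smooth_funs A"
  by (simp add: smooth_funs_iff scaleR_fun_def smooth_near_mult smooth_near_const)

lemma smooth_funs_zero [simp]: "0 \<in> smooth_funs A"
  by (simp add: zero_fun_def)

lemma smooth_funs_sum [simp]:
  "(\<And>a. a \<in> N \<Longrightarrow> f a \<in> smooth_funs A) \<Longrightarrow> sum f N \<in> smooth_funs A"
  by (induction N rule: infinite_finite_induct) simp_all

text \<open>In a chart \<open>\<phi>\<close> around \<open>x\<close> take \<open>exp (- 1 / (e\<^sup>2 - |\<phi> y - \<phi> x|\<^sup>2))\<close>. Its support lies in the preimage of
  a closed coordinate ball, which is compact and hence closed since the manifold is Hausdorff; the
  extension by \<open>0\<close> is therefore smooth.\<close>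

lemma bump_function:
  assumes "open W" "x \<in> W"
  obtains \<beta> K where "\<beta> \<in> smooth_funs A" "\<beta> x \<noteq> 0" "closed K" "K \<subseteq> W" "\<forall>y. y \<notin> K \<longrightarrow> \<beta> y = 0"
proof -
  obtain U \<phi> where U: "(U, \<phi>) \<in> A" "x \<in> U" by (rule chart_at)
  have "open (\<phi> ` (U \<inter> W))" "\<phi> x \<in> \<phi> ` (U \<inter> W)"
    using chart_image_Int_open[OF U(1) assms(1)] U(2) assms(2) by auto
  then obtain e where e: "0 < e" "cball (\<phi> x) e \<subseteq> \<phi> ` (U \<inter> W)"
    using open_contains_cball by blast
  define K where "K = inv_into U \<phi> ` cball (\<phi> x) e"
  have K_eq: "K = {y \<in> U \<inter> W. \<phi> y \<in> cball (\<phi> x) e}"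
  proof safe
    fix y assume "y \<in> K"
    then obtain z where z: "z \<in> cball (\<phi> x) e" "y = inv_into U \<phi> z" unfolding K_def by blast
    obtain y' where y': "y' \<in> U" "y' \<in> W" "z = \<phi> y'" using z(1) e(2) by auto
    then have "y = y'" using z(2) chart_inv[OF U(1)] by simp
    then show "y \<in> U" "y \<in> W" "\<phi> y \<in> cball (\<phi> x) e" using y' z(1) by auto
  next
    fix y assume "y \<in> U" "\<phi> y \<in> cball (\<phi> x) e"
    then show "y \<in> K" unfolding K_def using chart_inv[OF U(1), of y] by (metis imageI)
  qed
  then have K_sub: "K \<subseteq> U \<inter> W" by auto
  have "continuous_on (cball (\<phi> x) e) (inv_into U \<phi>)"
    using homeomorphism_cont2[OF chart_homeomorphism[OF U(1)]]
    by (rule continuous_on_subset) (use e(2) in auto)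
  then have "closed K"
    unfolding K_def by (intro compact_imp_closed compact_continuous_image) auto
  \<comment> \<open>positive exactly inside the coordinate ball, and written with sums and products only, to
    match the closure properties of \<^const>\<open>Ck_on\<close>\<close>
  define \<rho> where "\<rho> y = e\<^sup>2 + (-1) * ((\<phi> y + - \<phi> x) \<bullet> (\<phi> y + - \<phi> x))" for y
  define \<beta> where "\<beta> y = (if y \<in> U then flat_exp 0 (\<rho> y) else 0)" for y
  have \<beta>0: "\<beta> y = 0" if "y \<notin> K" for y
  proof (cases "y \<in> U")
    case True
    then have "\<phi> y \<notin> cball (\<phi> x) e"
      using that chart_inv[OF U(1), of y] unfolding K_def by (metis imageI)
    then have "e < norm (\<phi> y - \<phi> x)"
      by (simp add: dist_norm norm_minus_commute)
    then have "e\<^sup>2 < (\<phi> y - \<phi> x) \<bullet> (\<phi> y - \<phi> x)"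
      using e(1) by (metis less_imp_le power2_norm_eq_inner power_strict_mono zero_less_numeral)
    then show ?thesis by (simp add: \<beta>_def \<rho>_def flat_exp_def)
  qed (simp add: \<beta>_def)
  have "smooth_fun_on A U \<beta>"
    unfolding smooth_fun_on_iff_Ck
  proof (intro allI impI)
    fix U' \<phi>' k assume U': "(U', \<phi>') \<in> A"
    have op: "open (\<phi>' ` (U' \<inter> U))"
      using chart_image_Int_open[OF U' chart_open[OF U(1)]] .
    have "Ck_on k (\<phi>' ` (U' \<inter> U)) (\<lambda>z. \<phi> (inv_into U' \<phi>' z))"
      using chart_transition[OF U' U(1)] by (simp add: smooth_on_def o_def)
    then have "Ck_on k (\<phi>' ` (U' \<inter> U)) (\<lambda>z. flat_exp 0 (\<rho> (inv_into U' \<phi>' z)))"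
      unfolding \<rho>_def using op
      by (intro Ck_on_flat_exp Ck_on_add Ck_on_mult Ck_on_inner Ck_on_const)
    then show "Ck_on k (\<phi>' ` (U' \<inter> U)) (\<lambda>z. \<beta> (inv_into U' \<phi>' z))"
      by (rule Ck_on_cong[OF op, rotated]) (use chart_inv[OF U'] in \<open>auto simp: \<beta>_def\<close>)
  qed
  have "smooth_near A y \<beta>" for y
  proof (cases "y \<in> U")
    case True
    then show ?thesis
      using \<open>smooth_fun_on A U \<beta>\<close> chart_open[OF U(1)] unfolding smooth_near_def by auto
  next
    case False
    have "\<forall>\<^sub>F y' in nhds y. 0 = \<beta> y'"
      unfolding eventually_nhds using \<open>closed K\<close> \<beta>0 K_sub False
      by (intro exI[of _ "- K"]) auto
    then show ?thesis using smooth_near_const by (rule smooth_near_cong)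
  qed
  then have "\<beta> \<in> smooth_funs A" by (simp add: smooth_funs_iff)
  moreover have "\<beta> x \<noteq> 0"
    using U e by (simp add: \<beta>_def \<rho>_def flat_exp_def)
  ultimately show ?thesis
    using that \<open>closed K\<close> K_sub \<beta>0 by blast
qed

end

lemma sum_fun_apply: "(\<Sum>a\<in>N. F a) x = (\<Sum>a\<in>N. F a x)"
  by (induction N rule: infinite_finite_induct) simp_all

lemma scaleR_fun_apply [simp]: "(c *\<^sub>R F) x = c *\<^sub>R F x"
  by (simp add: scaleR_fun_def)

lemma mult_field_apply: "mult_field f X x = f x *\<^sub>R X x"
  by (simp add: mult_field_def)

context smooth_mfd
begin

section \<open>Linear systems with smooth coefficients\<close>

text \<open>Gaussian elimination on germs: some entry \<open>G a0 b0\<close> of the row \<open>a0\<close> does not vanish at \<open>x\<close>, hence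
  is invertible near \<open>x\<close>, and eliminating with it leaves a nonsingular square system that is
  smaller by one row and one column. This provides the smooth inverse of a Gram matrix.\<close>

lemma linear_system_solvable_near:
  fixes G :: "'a \<Rightarrow> 'b \<Rightarrow> 'm \<Rightarrow> real"
  assumes "finite N" "finite M" "card N = card M"
    and "\<And>a b. a \<in> N \<Longrightarrow> b \<in> M \<Longrightarrow> smooth_near A x (G a b)"
    and "\<And>b. b \<in> M \<Longrightarrow> smooth_near A x (h b)"
    and "\<And>u. (\<And>b. b \<in> M \<Longrightarrow> (\<Sum>a\<in>N. u a * G a b x) = 0) \<Longrightarrow> \<forall>a\<in>N. u a = 0"
  shows "\<exists>c. (\<forall>a\<in>N. smooth_near A x (c a)) \<and>
    (\<forall>\<^sub>F y in nhds x. \<forall>b\<in>M. (\<Sum>a\<in>N. c a y * G a b y) = h b y)"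
  using assms
proof (induction N arbitrary: M G h rule: finite_induct)
  case empty
  then show ?case by simp
next
  case (insert a0 N)
  have "\<exists>b0\<in>M. G a0 b0 x \<noteq> 0"
  proof (rule ccontr)
    assume *: "\<not> ?thesis"
    have "(\<Sum>a\<in>insert a0 N. (if a = a0 then 1 else 0) * G a b x) = 0" if "b \<in> M" for b
      using * that by (intro sum.neutral) auto
    from insert.prems(5)[OF this] show False by auto
  qed
  then obtain b0 where b0: "b0 \<in> M" "G a0 b0 x \<noteq> 0" by blast
  \<comment> \<open>the multiple of the column \<open>b0\<close> to be subtracted from the column \<open>b\<close>\<close>
  define q where "q b y = G a0 b y * inverse (G a0 b0 y)" for b y
  define G' where "G' a b y = G a b y - G a b0 y * q b y" for a b y
  define h' where "h' b y = h b y - h b0 y * q b y" for b y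
  have near_inv: "smooth_near A x (\<lambda>y. inverse (G a0 b0 y))"
    using insert.prems(3) b0 by (intro smooth_near_inverse) auto
  have near_q: "smooth_near A x (q b)" if "b \<in> M" for b
    unfolding q_def using insert.prems(3) that by (intro smooth_near_mult near_inv) auto
  have "\<exists>c. (\<forall>a\<in>N. smooth_near A x (c a)) \<and>
    (\<forall>\<^sub>F y in nhds x. \<forall>b\<in>M - {b0}. (\<Sum>a\<in>N. c a y * G' a b y) = h' b y)"
  proof (rule insert.IH)
    show "finite (M - {b0})" using insert.prems(1) by simp
    show "card N = card (M - {b0})"
      using insert.prems(1,2) insert.hyps b0(1) by simp
    show "smooth_near A x (G' a b)" if "a \<in> N" "b \<in> M - {b0}" for a b
      unfolding G'_def using insert.prems(3) near_q b0(1) that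
      by (intro smooth_near_diff smooth_near_mult) auto
    show "smooth_near A x (h' b)" if "b \<in> M - {b0}" for b
      unfolding h'_def using insert.prems(4) near_q b0(1) that
      by (intro smooth_near_diff smooth_near_mult) auto
  next
    fix u assume u: "\<And>b. b \<in> M - {b0} \<Longrightarrow> (\<Sum>a\<in>N. u a * G' a b x) = 0"
    define s where "s b = (\<Sum>a\<in>N. u a * G a b x)" for b
    \<comment> \<open>a kernel vector of the reduced matrix extends to one of \<open>G\<close> at \<open>x\<close>; the value at \<open>a0\<close> is forced
      by the column \<open>b0\<close>\<close>
    define u' where "u' = u(a0 := - s b0 * inverse (G a0 b0 x))"
    have "(\<Sum>a\<in>insert a0 N. u' a * G a b x) = 0" if "b \<in> M" for b
    proof -
      have "(\<Sum>a\<in>N. u' a * G a b x) = s b"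
        unfolding u'_def s_def using insert.hyps(2) by (intro sum.cong) auto
      then have *: "(\<Sum>a\<in>insert a0 N. u' a * G a b x) = s b - s b0 * q b x"
        using insert.hyps by (simp add: u'_def q_def)
      have "s b - s b0 * q b x = (\<Sum>a\<in>N. u a * G' a b x)"
        by (simp add: s_def G'_def sum_distrib_right right_diff_distrib sum_subtractf mult.assoc)
      then show ?thesis
        using * u[of b] that b0(2) by (cases "b = b0") (simp_all add: q_def)
    qed
    from insert.prems(5)[OF this] show "\<forall>a\<in>N. u a = 0"
      using insert.hyps(2) by (auto simp: u'_def split: if_splits)
  qed
  then obtain c where c: "\<And>a. a \<in> N \<Longrightarrow> smooth_near A x (c a)"
    and c_eq: "\<forall>\<^sub>F y in nhds x. \<forall>b\<in>M - {b0}. (\<Sum>a\<in>N. c a y * G' a b y) = h' b y"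
    by blast
  define c0 where "c0 y = (h b0 y - (\<Sum>a\<in>N. c a y * G a b0 y)) * inverse (G a0 b0 y)" for y
  have "smooth_near A x c0"
    unfolding c0_def using insert.prems(3,4) b0(1) c near_inv
    by (intro smooth_near_mult smooth_near_diff smooth_near_sum) auto
  moreover have "\<forall>\<^sub>F y in nhds x. \<forall>b\<in>M.
      (\<Sum>a\<in>insert a0 N. (c(a0 := c0)) a y * G a b y) = h b y"
    using c_eq smooth_near_eventually_nonzero[OF insert.prems(3)[OF insertI1 b0(1)] b0(2)]
  proof eventually_elim
    case (elim y)
    show ?case
    proof
      fix b assume b: "b \<in> M"
      define s where "s b = (\<Sum>a\<in>N. c a y * G a b y)" for b
      have "(\<Sum>a\<in>N. (c(a0 := c0)) a y * G a b y) = s b"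
        unfolding s_def using insert.hyps(2) by (intro sum.cong) auto
      then have *: "(\<Sum>a\<in>insert a0 N. (c(a0 := c0)) a y * G a b y) = s b + (h b0 y - s b0) * q b y"
        using insert.hyps by (simp add: c0_def q_def s_def)
      have **: "s b - s b0 * q b y = (\<Sum>a\<in>N. c a y * G' a b y)"
        by (simp add: s_def G'_def sum_distrib_right right_diff_distrib sum_subtractf mult.assoc)
      show "(\<Sum>a\<in>insert a0 N. (c(a0 := c0)) a y * G a b y) = h b y"
      proof (cases "b = b0")
        case True
        then show ?thesis using * elim(2) by (simp add: q_def)
      next
        case False
        then have "s b - s b0 * q b y = h b y - h b0 y * q b y"
          using ** elim(1) b by (simp add: h'_def)
        then show ?thesis using * by (simp add: algebra_simps)
      qed
    qed
  qed
  ultimately show ?case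
    using c by (intro exI[of _ "c(a0 := c0)"]) auto
qed

section \<open>Tangent vectors and vector fields\<close>

lemma tangent_add: "v \<in> tangent_space A x \<Longrightarrow> f \<in> smooth_funs A \<Longrightarrow> h \<in> smooth_funs A \<Longrightarrow>
    v (f + h) = v f + v h"
  and tangent_scaleR: "v \<in> tangent_space A x \<Longrightarrow> f \<in> smooth_funs A \<Longrightarrow> v (c *\<^sub>R f) = c * v f"
  and tangent_mult: "v \<in> tangent_space A x \<Longrightarrow> f \<in> smooth_funs A \<Longrightarrow> h \<in> smooth_funs A \<Longrightarrow>
    v (f * h) = f x * v h + h x * v f"
  and tangent_nonsmooth: "v \<in> tangent_space A x \<Longrightarrow> f \<notin> smooth_funs A \<Longrightarrow> v f = 0"
  unfolding tangent_space_def by blast+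

lemma tangent_diff:
  assumes "v \<in> tangent_space A x" "f \<in> smooth_funs A" "h \<in> smooth_funs A"
  shows "v (f - h) = v f - v h"
  using tangent_add[of v x "f - h" h] assms by simp

lemma tangent_zero_fun: "v \<in> tangent_space A x \<Longrightarrow> v 0 = 0"
  using tangent_scaleR[of v x 0 0] by simp

lemma subspace_tangent_space: "subspace (tangent_space A x)"
  unfolding subspace_def tangent_space_def
  by (auto simp: scaleR_fun_def algebra_simps)

lemmas tangent_space_zero [simp] = subspace_0[OF subspace_tangent_space]
lemmas tangent_space_add [simp] = subspace_add[OF subspace_tangent_space]
lemmas tangent_space_diff [simp] = subspace_diff[OF subspace_tangent_space]
lemmas tangent_space_scaleR [simp] = subspace_scale[OF subspace_tangent_space]
lemmas tangent_space_sum [simp] = subspace_sum[OF subspace_tangent_space]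

lemma vector_fields_iff:
  "X \<in> vector_fields A \<longleftrightarrow>
    (\<forall>x. X x \<in> tangent_space A x \<and> (\<forall>f\<in>smooth_funs A. smooth_near A x (dir_deriv X f)))"
proof -
  have "smooth_fun_on A UNIV h \<longleftrightarrow> (\<forall>x. smooth_near A x h)" for h
    using smooth_funs_iff[of h] by (simp add: smooth_funs_def)
  then show ?thesis
    unfolding vector_fields_def smooth_field_on_def by auto
qed

lemma vector_field_at [simp]: "X \<in> vector_fields A \<Longrightarrow> X x \<in> tangent_space A x"
  by (simp add: vector_fields_iff)

text \<open>For a function that is not smooth the derivative is the zero function, by the convention on
  tangent vectors.\<close>

lemma dir_deriv_smooth [simp]:
  assumes "X \<in> vector_fields A"
  shows "dir_deriv X f \<in> smooth_funs A"
proof (cases "f \<in> smooth_funs A")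
  case True
  then show ?thesis using assms unfolding vector_fields_iff smooth_funs_iff[of "dir_deriv X f"] by blast
next
  case False
  then have "dir_deriv X f = 0"
    using assms tangent_nonsmooth vector_field_at unfolding dir_deriv_def by fastforce
  then show ?thesis by simp
qed

lemma dir_deriv_field_simps:
  "dir_deriv (X + Y) f = dir_deriv X f + dir_deriv Y f"
  "dir_deriv (X - Y) f = dir_deriv X f - dir_deriv Y f"
  "dir_deriv (- X) f = - dir_deriv X f"
  "dir_deriv (c *\<^sub>R X) f = c *\<^sub>R dir_deriv X f"
  "dir_deriv 0 f = 0"
  "dir_deriv (mult_field h X) f = h * dir_deriv X f"
  "dir_deriv (lie_bracket X Y) f = dir_deriv X (dir_deriv Y f) - dir_deriv Y (dir_deriv X f)"
  by (simp_all add: dir_deriv_def mult_field_def lie_bracket_def scaleR_fun_def fun_eq_iff)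

lemma dir_deriv_fun_simps:
  assumes "X \<in> vector_fields A" "f \<in> smooth_funs A" "h \<in> smooth_funs A"
  shows "dir_deriv X (f + h) = dir_deriv X f + dir_deriv X h"
    "dir_deriv X (f - h) = dir_deriv X f - dir_deriv X h"
    "dir_deriv X (f * h) = f * dir_deriv X h + h * dir_deriv X f"
    "dir_deriv X (c *\<^sub>R f) = c *\<^sub>R dir_deriv X f"
  using tangent_add[OF vector_field_at[OF assms(1)] assms(2,3)]
    tangent_diff[OF vector_field_at[OF assms(1)] assms(2,3)]
    tangent_mult[OF vector_field_at[OF assms(1)] assms(2,3)]
    tangent_scaleR[OF vector_field_at[OF assms(1)] assms(2)]
  by (simp_all add: dir_deriv_def fun_eq_iff scaleR_fun_def[of c "\<lambda>x. X x f"])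

lemma dir_deriv_zero_fun: "X \<in> vector_fields A \<Longrightarrow> dir_deriv X 0 = 0"
  using tangent_zero_fun[OF vector_field_at] by (simp add: dir_deriv_def fun_eq_iff)

lemma dir_deriv_nonsmooth:
  "X \<in> vector_fields A \<Longrightarrow> f \<notin> smooth_funs A \<Longrightarrow> dir_deriv X f = 0"
  using tangent_nonsmooth vector_field_at unfolding dir_deriv_def by fastforce

lemma vector_fieldI:
  assumes "\<And>x. X x \<in> tangent_space A x" "\<And>f. f \<in> smooth_funs A \<Longrightarrow> dir_deriv X f \<in> smooth_funs A"
  shows "X \<in> vector_fields A"
  unfolding vector_fields_iff using assms smooth_funs_near by blast

lemma vector_fields_zero [simp]: "0 \<in> vector_fields A"
  by (rule vector_fieldI) (simp_all add: dir_deriv_field_simps)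

lemma vector_fields_add [simp]:
  "X \<in> vector_fields A \<Longrightarrow> Y \<in> vector_fields A \<Longrightarrow> X + Y \<in> vector_fields A"
  by (rule vector_fieldI) (simp_all add: dir_deriv_field_simps)

lemma vector_fields_diff [simp]:
  "X \<in> vector_fields A \<Longrightarrow> Y \<in> vector_fields A \<Longrightarrow> X - Y \<in> vector_fields A"
  by (rule vector_fieldI) (simp_all add: dir_deriv_field_simps)

lemma vector_fields_uminus [simp]: "X \<in> vector_fields A \<Longrightarrow> - X \<in> vector_fields A"
  using vector_fields_diff[of 0 X] by simp

lemma vector_fields_scaleR [simp]: "X \<in> vector_fields A \<Longrightarrow> c *\<^sub>R X \<in> vector_fields A"
  by (rule vector_fieldI) (simp_all add: dir_deriv_field_simps)

lemma vector_fields_mult [simp]: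
  "X \<in> vector_fields A \<Longrightarrow> f \<in> smooth_funs A \<Longrightarrow> mult_field f X \<in> vector_fields A"
  by (rule vector_fieldI) (simp_all add: dir_deriv_field_simps mult_field_apply)

lemma vector_fields_sum [simp]:
  "(\<And>a. a \<in> N \<Longrightarrow> F a \<in> vector_fields A) \<Longrightarrow> sum F N \<in> vector_fields A"
  by (induction N rule: infinite_finite_induct) simp_all

lemma lie_bracket_closed [simp]:
  assumes X: "X \<in> vector_fields A" and Y: "Y \<in> vector_fields A"
  shows "lie_bracket X Y \<in> vector_fields A"
proof (rule vector_fieldI)
  let ?d = "\<lambda>f. dir_deriv X (dir_deriv Y f) - dir_deriv Y (dir_deriv X f)"
  fix x
  have at: "lie_bracket X Y x f = ?d f x" for f
    by (simp add: lie_bracket_def dir_deriv_def)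
  show "lie_bracket X Y x \<in> tangent_space A x"
    unfolding tangent_space_def mem_Collect_eq at
    using X Y by (auto simp: dir_deriv_fun_simps dir_deriv_nonsmooth dir_deriv_zero_fun algebra_simps)
next
  show "dir_deriv (lie_bracket X Y) f \<in> smooth_funs A" for f
    using X Y by (simp add: dir_deriv_field_simps)
qed

lemma lie_bracket_commute: "lie_bracket X Y = - lie_bracket Y X"
  by (simp add: lie_bracket_def fun_eq_iff)

lemma lie_bracket_add_right:
  assumes "X \<in> vector_fields A" "Y \<in> vector_fields A" "Z \<in> vector_fields A"
  shows "lie_bracket X (Y + Z) = lie_bracket X Y + lie_bracket X Z"
proof -
  have "X x (dir_deriv (Y + Z) f) = X x (dir_deriv Y f) + X x (dir_deriv Z f)" for x f
    using assms tangent_add[of "X x" x "dir_deriv Y f" "dir_deriv Z f"]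
    by (simp add: dir_deriv_field_simps)
  then show ?thesis by (simp add: lie_bracket_def fun_eq_iff)
qed

lemma lie_bracket_mult_right:
  assumes "X \<in> vector_fields A" "Y \<in> vector_fields A" "f \<in> smooth_funs A"
  shows "lie_bracket X (mult_field f Y) = mult_field (dir_deriv X f) Y + mult_field f (lie_bracket X Y)"
proof -
  have "X x (dir_deriv (mult_field f Y) h) = f x * X x (dir_deriv Y h) + Y x h * X x f" for x h
    using assms tangent_mult[of "X x" x f "dir_deriv Y h"]
    by (simp add: dir_deriv_field_simps) (simp add: dir_deriv_def)
  then show ?thesis
    by (simp add: lie_bracket_def mult_field_def scaleR_fun_def fun_eq_iff algebra_simps)
       (simp add: dir_deriv_def)
qed

lemma lie_bracket_add_left:
  assumes "X \<in> vector_fields A" "Y \<in> vector_fields A" "Z \<in> vector_fields A"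
  shows "lie_bracket (X + Y) Z = lie_bracket X Z + lie_bracket Y Z"
  using lie_bracket_add_right[of Z X Y] assms lie_bracket_commute[of "X + Y" Z]
    lie_bracket_commute[of X Z] lie_bracket_commute[of Y Z] by simp

lemma lie_bracket_mult_left:
  assumes "X \<in> vector_fields A" "Y \<in> vector_fields A" "f \<in> smooth_funs A"
  shows "lie_bracket (mult_field f X) Y = mult_field f (lie_bracket X Y) - mult_field (dir_deriv Y f) X"
  using lie_bracket_mult_right[of Y X f] assms lie_bracket_commute[of "mult_field f X" Y]
    lie_bracket_commute[of X Y] by (simp add: mult_field_def fun_eq_iff scaleR_fun_def)

lemma lie_bracket_zero:
  assumes "X \<in> vector_fields A"
  shows "lie_bracket X 0 = 0" "lie_bracket 0 X = 0"
  using lie_bracket_add_right[of X 0 0] lie_bracket_add_left[of 0 0 X] assms by simp_all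

end

section \<open>Frames adapted to a splitting\<close>

lemma span_image_finite:
  fixes e :: "'a \<Rightarrow> 'v::real_vector"
  assumes "finite N" "inj_on e N" "v \<in> span (e ` N)"
  obtains c where "v = (\<Sum>a\<in>N. c a *\<^sub>R e a)"
proof -
  obtain u where "v = (\<Sum>w\<in>e ` N. u w *\<^sub>R w)"
    using assms(1,3) by (auto simp: span_finite)
  then have "v = (\<Sum>a\<in>N. u (e a) *\<^sub>R e a)"
    by (simp add: sum.reindex[OF assms(2)])
  then show ?thesis by (rule that)
qed

lemma independent_image_finite:
  fixes e :: "'a \<Rightarrow> 'v::real_vector"
  assumes "finite N" "inj_on e N" "independent (e ` N)" "(\<Sum>a\<in>N. c a *\<^sub>R e a) = 0" "a \<in> N"
  shows "c a = 0"
proof -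
  define u where "u w = c (the_inv_into N e w)" for w
  have u: "u (e a) = c a" if "a \<in> N" for a
    using that assms(2) by (simp add: u_def the_inv_into_f_f)
  have "(\<Sum>w\<in>e ` N. u w *\<^sub>R w) = (\<Sum>a\<in>N. c a *\<^sub>R e a)"
    by (simp add: sum.reindex[OF assms(2)] u)
  then have "u (e a) = 0"
    using assms by (intro independentD[OF assms(3)]) auto
  then show ?thesis using u assms(5) by simp
qed

text \<open>A Witt structure as seen by the metric: anisotropic summands are dual to themselves, and isotropic
  ones are dual to their partners. In both cases \<open>V i\<close> is orthogonal to every summand except
  \<open>V (d i)\<close>, which lets both kinds be treated alike.\<close>

locale dual_splitting = smooth_mfd A
  for A :: "('m::{t2_space,second_countable_topology}, 'e::euclidean_space) atlas" +
  fixes g :: "'m metric"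
    and I :: "int set"
    and d :: "int \<Rightarrow> int"
    and V :: "int \<Rightarrow> 'm \<Rightarrow> 'm tangent set"
  assumes metric: "pseudo_riemannian_metric A g"
    and finite_I [simp]: "finite I"
    and dual_in [simp]: "i \<in> I \<Longrightarrow> d i \<in> I"
    and dual_dual [simp]: "i \<in> I \<Longrightarrow> d (d i) = i"
    and subbundle: "i \<in> I \<Longrightarrow> \<exists>n. subbundle A n (V i)"
    and decomp: "v \<in> tangent_space A x \<Longrightarrow> \<exists>!u. is_decomp I (\<lambda>i. V i x) v u"
    and orthogonal: "i \<in> I \<Longrightarrow> j \<in> I \<Longrightarrow> j \<noteq> d i \<Longrightarrow> v \<in> V i x \<Longrightarrow> w \<in> V j x \<Longrightarrow> g x v w = 0"
begin

lemma g_lincomb: "u \<in> tangent_space A x \<Longrightarrow> v \<in> tangent_space A x \<Longrightarrow> w \<in> tangent_space A x \<Longrightarrow>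
    g x (a *\<^sub>R u + b *\<^sub>R v) w = a * g x u w + b * g x v w"
  using metric[unfolded pseudo_riemannian_metric_def, THEN conjunct1] by simp

lemma g_commute: "v \<in> tangent_space A x \<Longrightarrow> w \<in> tangent_space A x \<Longrightarrow> g x v w = g x w v"
  using metric[unfolded pseudo_riemannian_metric_def, THEN conjunct2, THEN conjunct1, rule_format] .

lemma g_nondegenerate:
  assumes "v \<in> tangent_space A x" "\<And>w. w \<in> tangent_space A x \<Longrightarrow> g x v w = 0"
  shows "v = 0"
  using metric[unfolded pseudo_riemannian_metric_def, THEN conjunct2, THEN conjunct2, THEN conjunct1]
    assms by simp

lemma g_smooth [simp]:
  "X \<in> vector_fields A \<Longrightarrow> Y \<in> vector_fields A \<Longrightarrow> metric_fun g X Y \<in> smooth_funs A"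
  using metric[unfolded pseudo_riemannian_metric_def, THEN conjunct2, THEN conjunct2, THEN conjunct2]
  by simp

lemma g_add_left: "u \<in> tangent_space A x \<Longrightarrow> v \<in> tangent_space A x \<Longrightarrow> w \<in> tangent_space A x \<Longrightarrow>
    g x (u + v) w = g x u w + g x v w"
  using g_lincomb[of u x v w 1 1] by simp

lemma g_scaleR_left: "u \<in> tangent_space A x \<Longrightarrow> w \<in> tangent_space A x \<Longrightarrow>
    g x (c *\<^sub>R u) w = c * g x u w"
  using g_lincomb[of u x u w c 0] by simp

lemma g_zero_left: "w \<in> tangent_space A x \<Longrightarrow> g x 0 w = 0"
  using g_scaleR_left[of w x w 0] by simp

lemma g_diff_left: "u \<in> tangent_space A x \<Longrightarrow> v \<in> tangent_space A x \<Longrightarrow> w \<in> tangent_space A x \<Longrightarrow>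
    g x (u - v) w = g x u w - g x v w"
  using g_lincomb[of u x v w 1 "-1"] by simp

lemma g_sum_left: "(\<And>a. a \<in> N \<Longrightarrow> F a \<in> tangent_space A x) \<Longrightarrow> w \<in> tangent_space A x \<Longrightarrow>
    g x (\<Sum>a\<in>N. c a *\<^sub>R F a) w = (\<Sum>a\<in>N. c a * g x (F a) w)"
  by (induction N rule: infinite_finite_induct) (simp_all add: g_zero_left g_add_left g_scaleR_left)

lemma g_sum_right:
  assumes "\<And>a. a \<in> N \<Longrightarrow> F a \<in> tangent_space A x" "w \<in> tangent_space A x"
  shows "g x w (\<Sum>a\<in>N. c a *\<^sub>R F a) = (\<Sum>a\<in>N. c a * g x w (F a))"
proof -
  have "g x w (\<Sum>a\<in>N. c a *\<^sub>R F a) = g x (\<Sum>a\<in>N. c a *\<^sub>R F a) w"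
    using assms by (intro g_commute) auto
  also have "\<dots> = (\<Sum>a\<in>N. c a * g x (F a) w)"
    using assms by (simp add: g_sum_left)
  also have "\<dots> = (\<Sum>a\<in>N. c a * g x w (F a))"
    using assms by (intro sum.cong) (auto intro!: g_commute)
  finally show ?thesis .
qed

lemma fibre_frame:
  assumes "i \<in> I"
  obtains n W E where "open W" "x \<in> W" "\<And>a. a < n \<Longrightarrow> smooth_field_on A W (E a)"
    "\<And>y. y \<in> W \<Longrightarrow> inj_on (\<lambda>a. E a y) {..<n}"
    "\<And>y. y \<in> W \<Longrightarrow> independent ((\<lambda>a. E a y) ` {..<n :: nat})"
    "\<And>y. y \<in> W \<Longrightarrow> span ((\<lambda>a. E a y) ` {..<n}) = V i y"
proof -
  obtain n where "subbundle A n (V i)" using subbundle[OF assms] by blast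
  then have "\<exists>W E. open W \<and> x \<in> W \<and> (\<forall>a<n. smooth_field_on A W (E a)) \<and>
      (\<forall>y\<in>W. inj_on (\<lambda>a. E a y) {..<n} \<and> independent ((\<lambda>a. E a y) ` {..<n}) \<and>
        span ((\<lambda>a. E a y) ` {..<n}) = V i y)"
    unfolding subbundle_def by simp
  then show ?thesis using that[of _ n] by metis
qed

lemma subspace_fibre: "i \<in> I \<Longrightarrow> subspace (V i x)"
  by (rule fibre_frame[of i x], assumption) (metis subspace_span)

lemmas fibre_zero [simp] = subspace_0[OF subspace_fibre]
lemmas fibre_sum = subspace_sum[OF subspace_fibre]
lemmas fibre_scaleR = subspace_scale[OF subspace_fibre]
lemmas fibre_add = subspace_add[OF subspace_fibre]

lemma fibre_tangent:
  assumes "i \<in> I" "v \<in> V i x"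
  shows "v \<in> tangent_space A x"
proof (rule fibre_frame[OF assms(1), of x])
  fix n W E
  assume *: "x \<in> W" "\<And>a. a < n \<Longrightarrow> smooth_field_on A W (E a)"
    "\<And>y. y \<in> W \<Longrightarrow> span ((\<lambda>a. E a y) ` {..<n :: nat}) = V i y"
  then have "(\<lambda>a. E a x) ` {..<n} \<subseteq> tangent_space A x"
    unfolding smooth_field_on_def by auto
  then have "span ((\<lambda>a. E a x) ` {..<n}) \<subseteq> tangent_space A x"
    by (rule span_minimal) (rule subspace_tangent_space)
  then show ?thesis using * assms(2) by auto
qed

text \<open>Multiplying a local frame by a bump function makes its members global sections, and they are
  still a frame where the bump function does not vanish. From here on all frames consist of global
  fields, on which brackets and forms are defined.\<close>

lemma subbundle_frame_near:
  assumes "i \<in> I"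
  shows "\<exists>(n::nat) E. (\<forall>a<n. E a \<in> sections A (V i)) \<and>
    (\<forall>\<^sub>F y in nhds x. (\<forall>v\<in>V i y. \<exists>c. v = (\<Sum>a<n. c a *\<^sub>R E a y)) \<and>
      (\<forall>c. (\<Sum>a<n. c a *\<^sub>R E a y) = 0 \<longrightarrow> (\<forall>a<n. c a = 0)))"
proof (rule fibre_frame[OF assms, of x])
  fix n W E0
  assume W: "open W" "x \<in> W" and E0: "\<And>a. a < n \<Longrightarrow> smooth_field_on A W (E0 a)"
    and inj: "\<And>y. y \<in> W \<Longrightarrow> inj_on (\<lambda>a. E0 a y) {..<n}"
    and indep: "\<And>y. y \<in> W \<Longrightarrow> independent ((\<lambda>a. E0 a y) ` {..<n :: nat})"
    and span: "\<And>y. y \<in> W \<Longrightarrow> span ((\<lambda>a. E0 a y) ` {..<n}) = V i y"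
  obtain \<beta> K where \<beta> [rule_format]: "\<beta> \<in> smooth_funs A" "\<beta> x \<noteq> 0" "closed K" "K \<subseteq> W" "\<forall>y. y \<notin> K \<longrightarrow> \<beta> y = 0"
    by (rule bump_function[OF W])
  define E where "E a = mult_field \<beta> (E0 a)" for a
  have E_fibre: "E a y \<in> V i y" if "a < n" for a y
  proof (cases "y \<in> W")
    case True
    have "E0 a y \<in> span ((\<lambda>a. E0 a y) ` {..<n})" using that by (intro span_base) auto
    then have "E0 a y \<in> V i y" by (simp only: span[OF True])
    then show ?thesis unfolding E_def mult_field_apply by (rule fibre_scaleR[OF assms])
  next
    case False
    then have "\<beta> y = 0" using \<beta>(4,5) by blast
    then show ?thesis using assms by (simp add: E_def mult_field_apply)
  qed
  have E_section: "E a \<in> sections A (V i)" if a: "a < n" for a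
    unfolding sections_def vector_fields_iff
  proof (intro CollectI conjI allI ballI)
    fix y show "E a y \<in> V i y" using E_fibre[OF a] .
    then show "E a y \<in> tangent_space A y" using fibre_tangent[OF assms] by blast
    fix f assume f: "f \<in> smooth_funs A"
    show "smooth_near A y (dir_deriv (E a) f)"
    proof (cases "y \<in> W")
      case True
      then have "smooth_near A y (dir_deriv (E0 a) f)"
        using E0[OF a] W(1) f unfolding smooth_field_on_def smooth_near_def by blast
      then have "smooth_near A y (\<lambda>z. \<beta> z * dir_deriv (E0 a) f z)"
        using smooth_funs_near[OF \<beta>(1)] by (rule smooth_near_mult[rotated])
      then show ?thesis by (simp add: E_def dir_deriv_def mult_field_apply)
    next
      case False
      have "\<forall>\<^sub>F z in nhds y. 0 = dir_deriv (E a) f z"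
        unfolding eventually_nhds using False \<beta>(3,4,5)
        by (intro exI[of _ "- K"]) (auto simp: E_def dir_deriv_def mult_field_apply)
      then show ?thesis using smooth_near_const by (rule smooth_near_cong)
    qed
  qed
  have "\<forall>\<^sub>F y in nhds x. y \<in> W" using W by (rule eventually_nhds_in_open)
  then have "\<forall>\<^sub>F y in nhds x. (\<forall>v\<in>V i y. \<exists>c. v = (\<Sum>a<n. c a *\<^sub>R E a y)) \<and>
      (\<forall>c. (\<Sum>a<n. c a *\<^sub>R E a y) = 0 \<longrightarrow> (\<forall>a<n. c a = 0))"
    using smooth_near_eventually_nonzero[OF smooth_funs_near[OF \<beta>(1)] \<beta>(2)]
  proof eventually_elim
    case (elim y)
    show ?case
    proof (intro conjI ballI allI impI)
      fix v assume "v \<in> V i y"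
      then obtain c where "v = (\<Sum>a<n. c a *\<^sub>R E0 a y)"
        using span_image_finite[OF _ inj[OF elim(1)], of v] span[OF elim(1)] by auto
      then have "v = (\<Sum>a<n. (c a * inverse (\<beta> y)) *\<^sub>R E a y)"
        using elim(2) by (simp add: E_def mult_field_apply mult.assoc)
      then show "\<exists>c. v = (\<Sum>a<n. c a *\<^sub>R E a y)"
        by (intro exI[of _ "\<lambda>a. c a * inverse (\<beta> y)"])
    next
      fix c a assume "(\<Sum>a<n. c a *\<^sub>R E a y) = 0" and a: "a < n"
      then have "(\<Sum>a<n. (c a * \<beta> y) *\<^sub>R E0 a y) = 0" by (simp add: E_def mult_field_apply)
      from independent_image_finite[OF _ inj[OF elim(1)] indep[OF elim(1)] this] a elim(2)
      show "c a = 0" by simp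
    qed
  qed
  then show ?thesis using E_section by blast
qed

text \<open>The index \<open>(i, a)\<close> will denote the \<open>a\<close>-th member of a frame of \<open>V i\<close>.\<close>

definition frame_at :: "(int \<times> nat) set \<Rightarrow> (int \<times> nat \<Rightarrow> 'm field) \<Rightarrow> 'm \<Rightarrow> bool"
  where "frame_at N E y \<longleftrightarrow>
    (\<forall>v\<in>tangent_space A y. \<exists>c. v = (\<Sum>b\<in>N. c b *\<^sub>R E b y)) \<and>
    (\<forall>c. (\<Sum>b\<in>N. c b *\<^sub>R E b y) = 0 \<longrightarrow> (\<forall>b\<in>N. c b = 0))"

lemma frame_at_independent:
  "frame_at N E y \<Longrightarrow> (\<Sum>b\<in>N. c b *\<^sub>R E b y) = 0 \<Longrightarrow> b \<in> N \<Longrightarrow> c b = 0"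
  by (simp add: frame_at_def)

lemma is_decomp_sum:
  assumes "\<And>i. i \<in> I \<Longrightarrow> F i \<in> V i x"
  shows "is_decomp I (\<lambda>i. V i x) (\<Sum>i\<in>I. F i) (\<lambda>i. if i \<in> I then F i else 0)"
  using assms by (simp add: is_decomp_def)

lemma decomp_unique:
  "v \<in> tangent_space A x \<Longrightarrow> is_decomp I (\<lambda>i. V i x) v u \<Longrightarrow> is_decomp I (\<lambda>i. V i x) v u' \<Longrightarrow> u = u'"
  using decomp by blast

text \<open>The frames of the subbundles are joined into one of the tangent bundle: they span because every
  vector has components, and are independent because the components of \<open>0\<close> are unique.\<close>

lemma frame_near:
  obtains N E where "finite N" "\<forall>b\<in>N. fst b \<in> I"
    "\<forall>b\<in>N. E b \<in> sections A (V (fst b))" "\<forall>\<^sub>F y in nhds x. frame_at N E y"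
proof -
  define P where "P i n E \<longleftrightarrow> (\<forall>a<n. E a \<in> sections A (V i)) \<and>
    (\<forall>\<^sub>F y in nhds x. (\<forall>v\<in>V i y. \<exists>c. v = (\<Sum>a<n. c a *\<^sub>R E a y)) \<and>
      (\<forall>c. (\<Sum>a<n. c a *\<^sub>R E a y) = 0 \<longrightarrow> (\<forall>a<n. c a = 0)))" for i and n :: nat and E
  have "\<exists>n E. P i n E" if "i \<in> I" for i
    using subbundle_frame_near[OF that, of x] unfolding P_def .
  then obtain n E0 where P: "\<And>i. i \<in> I \<Longrightarrow> P i (n i) (E0 i)"
    by metis
  have sec: "E0 i a \<in> sections A (V i)" if "i \<in> I" "a < n i" for i a
    using P[OF that(1)] that(2) unfolding P_def by blast
  have ev: "\<forall>\<^sub>F y in nhds x. (\<forall>v\<in>V i y. \<exists>c. v = (\<Sum>a<n i. c a *\<^sub>R E0 i a y)) \<and>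
      (\<forall>c. (\<Sum>a<n i. c a *\<^sub>R E0 i a y) = 0 \<longrightarrow> (\<forall>a<n i. c a = 0))" if "i \<in> I" for i
    using P[OF that] unfolding P_def by blast
  \<comment> \<open>the ranks differ from summand to summand, hence the dependent index set\<close>
  define N where "N = (SIGMA i:I. {..<n i :: nat})"
  define E where "E b = E0 (fst b) (snd b)" for b
  have sum_N: "(\<Sum>b\<in>N. c b *\<^sub>R E b y) = (\<Sum>i\<in>I. \<Sum>a<n i. c (i, a) *\<^sub>R E0 i a y)" for c y
    unfolding N_def E_def by (subst sum.Sigma) (auto simp: case_prod_beta)
  have "\<forall>\<^sub>F y in nhds x. \<forall>i\<in>I. (\<forall>v\<in>V i y. \<exists>c. v = (\<Sum>a<n i. c a *\<^sub>R E0 i a y)) \<and>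
      (\<forall>c. (\<Sum>a<n i. c a *\<^sub>R E0 i a y) = 0 \<longrightarrow> (\<forall>a<n i. c a = 0))"
    using ev by (intro eventually_ball_finite) auto
  then have "\<forall>\<^sub>F y in nhds x. frame_at N E y"
  proof eventually_elim
    case (elim y)
    show ?case
      unfolding frame_at_def
    proof (intro conjI ballI allI impI)
      fix v assume v: "v \<in> tangent_space A y"
      obtain u where u: "\<And>i. i \<in> I \<Longrightarrow> u i \<in> V i y" "v = (\<Sum>i\<in>I. u i)"
        using decomp[OF v] unfolding is_decomp_def by blast
      have "\<forall>i\<in>I. \<exists>c. u i = (\<Sum>a<n i. c a *\<^sub>R E0 i a y)" using elim u(1) by blast
      then obtain c where "\<forall>i\<in>I. u i = (\<Sum>a<n i. c i a *\<^sub>R E0 i a y)" by metis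
      then have "v = (\<Sum>b\<in>N. c (fst b) (snd b) *\<^sub>R E b y)" using u(2) by (simp add: sum_N)
      then show "\<exists>c. v = (\<Sum>b\<in>N. c b *\<^sub>R E b y)"
        by (intro exI[of _ "\<lambda>b. c (fst b) (snd b)"])
    next
      fix c b assume c: "(\<Sum>b\<in>N. c b *\<^sub>R E b y) = 0" and b: "b \<in> N"
      define F where "F i = (\<Sum>a<n i. c (i, a) *\<^sub>R E0 i a y)" for i
      have "F i \<in> V i y" if "i \<in> I" for i
        unfolding F_def using that sec
        by (intro fibre_sum fibre_scaleR) (auto simp: sections_def)
      moreover have "(\<Sum>i\<in>I. F i) = 0" using c by (simp add: F_def sum_N)
      ultimately have "is_decomp I (\<lambda>i. V i y) 0 (\<lambda>i. if i \<in> I then F i else 0)"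
        using is_decomp_sum[of F y] by simp
      moreover have "is_decomp I (\<lambda>i. V i y) 0 (\<lambda>_. 0)"
        by (simp add: is_decomp_def)
      ultimately have F0: "(\<lambda>i. if i \<in> I then F i else 0) = (\<lambda>_. 0)"
        by (rule decomp_unique[rotated]) simp
      have "F (fst b) = 0"
        using b fun_cong[OF F0, of "fst b"] by (auto simp: N_def)
      moreover have b': "fst b \<in> I" "snd b < n (fst b)" using b by (auto simp: N_def)
      then have "\<forall>c. (\<Sum>a<n (fst b). c a *\<^sub>R E0 (fst b) a y) = 0 \<longrightarrow> (\<forall>a<n (fst b). c a = 0)"
        using elim by blast
      from this[rule_format, of "\<lambda>a. c (fst b, a)" "snd b"] b'
      have "F (fst b) = 0 \<Longrightarrow> c b = 0" unfolding F_def by simp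
      ultimately show "c b = 0" by simp
    qed
  qed
  then show ?thesis
    using that[of N E] sec unfolding N_def E_def by (auto simp: mem_Sigma_iff)
qed

lemma section_vector_field [simp]: "X \<in> sections A (V i) \<Longrightarrow> X \<in> vector_fields A"
  by (simp add: sections_def)

lemma frame_fields_near:
  obtains N E where "finite N" "\<forall>b\<in>N. E b \<in> vector_fields A"
    "\<forall>\<^sub>F y in nhds x. frame_at N E y"
proof (rule frame_near[of x])
  fix N E
  assume *: "finite N" "\<forall>b\<in>N. E b \<in> sections A (V (fst b))"
    "\<forall>\<^sub>F y in nhds x. frame_at N E y"
  show ?thesis using *(2) section_vector_field by (intro that[OF *(1) _ *(3)]) blast
qed

lemma frame_separates:
  assumes "frame_at N E y" "\<And>b. b \<in> N \<Longrightarrow> E b \<in> vector_fields A" "w \<in> tangent_space A y"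
    and "\<And>b. b \<in> N \<Longrightarrow> g y w (E b y) = 0"
  shows "w = 0"
proof (rule g_nondegenerate[OF assms(3)])
  fix v assume "v \<in> tangent_space A y"
  then obtain c where "v = (\<Sum>b\<in>N. c b *\<^sub>R E b y)" using assms(1) unfolding frame_at_def by blast
  then show "g y w v = 0" using assms(2-4) by (simp add: g_sum_right)
qed

text \<open>The coordinates of the representing field solve a linear system whose matrix is the Gram matrix of
  the frame; it is nonsingular because \<open>g\<close> is non-degenerate.\<close>

lemma riesz_near:
  assumes "finite N" "\<And>b. b \<in> N \<Longrightarrow> E b \<in> vector_fields A" "\<forall>\<^sub>F y in nhds x. frame_at N E y"
    and "\<And>b. b \<in> N \<Longrightarrow> smooth_near A x (h b)"
  obtains c where "\<forall>b\<in>N. smooth_near A x (c b)"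
    "\<forall>\<^sub>F y in nhds x. \<forall>b\<in>N. g y (\<Sum>a\<in>N. c a y *\<^sub>R E a y) (E b y) = h b y"
proof -
  have fx: "frame_at N E x" using assms(3) by (rule eventually_nhds_x_imp_x)
  have "\<exists>c. (\<forall>a\<in>N. smooth_near A x (c a)) \<and>
    (\<forall>\<^sub>F y in nhds x. \<forall>b\<in>N. (\<Sum>a\<in>N. c a y * metric_fun g (E a) (E b) y) = h b y)"
  proof (rule linear_system_solvable_near)
    fix u assume u: "\<And>b. b \<in> N \<Longrightarrow> (\<Sum>a\<in>N. u a * metric_fun g (E a) (E b) x) = 0"
    have "(\<Sum>a\<in>N. u a *\<^sub>R E a x) = 0"
      using fx assms(2) u by (intro frame_separates[OF fx]) (auto simp: g_sum_left metric_fun_def)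
    then show "\<forall>a\<in>N. u a = 0" using fx unfolding frame_at_def by blast
  qed (use assms in \<open>auto simp: smooth_funs_near\<close>)
  then show ?thesis
    using that assms(2) by (auto simp: g_sum_left metric_fun_def)
qed

text \<open>A smooth field has smooth coordinates: they are determined by its inner products with the frame,
  which are smooth. The metric thus replaces the dual frame.\<close>

lemma coefficients_near:
  assumes "finite N" "\<And>b. b \<in> N \<Longrightarrow> E b \<in> vector_fields A" "\<forall>\<^sub>F y in nhds x. frame_at N E y"
    and Z: "Z \<in> vector_fields A"
  obtains c where "\<forall>b\<in>N. smooth_near A x (c b)"
    "\<forall>\<^sub>F y in nhds x. Z y = (\<Sum>b\<in>N. c b y *\<^sub>R E b y)"
proof -
  have near: "smooth_near A x (metric_fun g Z (E b))" if "b \<in> N" for b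
    using Z assms(2) that by (intro smooth_funs_near g_smooth)
  obtain c where c [rule_format]: "\<forall>b\<in>N. smooth_near A x (c b)"
    "\<forall>\<^sub>F y in nhds x. \<forall>b\<in>N. g y (\<Sum>a\<in>N. c a y *\<^sub>R E a y) (E b y) = metric_fun g Z (E b) y"
    by (rule riesz_near[OF assms(1-3) near])
  have "\<forall>\<^sub>F y in nhds x. Z y = (\<Sum>b\<in>N. c b y *\<^sub>R E b y)"
    using c(2) assms(3)
  proof eventually_elim
    case (elim y)
    have "(\<Sum>b\<in>N. c b y *\<^sub>R E b y) - Z y = 0"
      using elim(1) assms(2) Z
      by (intro frame_separates[OF elim(2)]) (auto simp: g_diff_left metric_fun_def)
    then show ?case by simp
  qed
  then show ?thesis using that c(1) by blast
qed

lemma vector_field_locally_lincomb: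
  assumes "\<And>x. X x \<in> tangent_space A x"
    and "\<And>x. \<exists>(N :: (int \<times> nat) set) c E. (\<forall>b\<in>N. E b \<in> vector_fields A \<and> smooth_near A x (c b)) \<and>
      (\<forall>\<^sub>F y in nhds x. X y = (\<Sum>b\<in>N. c b y *\<^sub>R E b y))"
  shows "X \<in> vector_fields A"
  unfolding vector_fields_iff
proof (intro allI conjI ballI)
  fix x f assume f: "f \<in> smooth_funs A"
  obtain N :: "(int \<times> nat) set" and c E where E: "\<forall>b\<in>N. E b \<in> vector_fields A \<and> smooth_near A x (c b)"
      and X: "\<forall>\<^sub>F y in nhds x. X y = (\<Sum>b\<in>N. c b y *\<^sub>R E b y)"
    using assms(2) by blast
  have "smooth_near A x (\<lambda>y. \<Sum>b\<in>N. c b y * dir_deriv (E b) f y)"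
    using E by (intro smooth_near_sum smooth_near_mult) (auto intro: smooth_funs_near)
  then show "smooth_near A x (dir_deriv X f)"
    by (rule smooth_near_cong[rotated])
       (rule eventually_mono[OF X], simp add: dir_deriv_def sum_fun_apply)
qed (rule assms(1))

section \<open>Vector fields representing 1-forms\<close>

lemma smooth_cutoff:
  assumes "finite N" "\<And>b. b \<in> N \<Longrightarrow> smooth_near A x (c b)" "\<forall>\<^sub>F y in nhds x. P y"
  obtains \<beta> where "\<beta> \<in> smooth_funs A" "\<beta> x \<noteq> 0" "\<forall>y. \<beta> y \<noteq> 0 \<longrightarrow> P y"
    "\<forall>b\<in>N. \<beta> * c b \<in> smooth_funs A"
proof -
  have "\<forall>\<^sub>F y in nhds x. P y \<and> (\<forall>b\<in>N. smooth_near A y (c b))"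
    using assms by (intro eventually_conj eventually_ball_finite) (auto intro: smooth_near_eventually)
  then obtain W where W: "open W" "x \<in> W" "\<forall>y\<in>W. P y \<and> (\<forall>b\<in>N. smooth_near A y (c b))"
    unfolding eventually_nhds by blast
  obtain \<beta> K where \<beta> [rule_format]: "\<beta> \<in> smooth_funs A" "\<beta> x \<noteq> 0" "closed K" "K \<subseteq> W" "\<forall>y. y \<notin> K \<longrightarrow> \<beta> y = 0"
    by (rule bump_function[OF W(1,2)])
  have "\<beta> * c b \<in> smooth_funs A" if b: "b \<in> N" for b
    unfolding smooth_funs_iff
  proof
    fix y
    show "smooth_near A y (\<beta> * c b)"
    proof (cases "y \<in> W")
      case True
      then show ?thesis
        using smooth_near_mult[OF smooth_funs_near[OF \<beta>(1)], of y "c b"] W(3) b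
        by (simp add: times_fun_def)
    next
      case False
      have "\<forall>\<^sub>F z in nhds y. 0 = (\<beta> * c b) z"
        unfolding eventually_nhds using False \<beta>(3,4,5) by (intro exI[of _ "- K"]) auto
      then show ?thesis using smooth_near_const by (rule smooth_near_cong)
    qed
  qed
  then show ?thesis using that[of \<beta>] \<beta> W(3) by blast
qed

definition smooth_form :: "'m one_form \<Rightarrow> bool"
  where "smooth_form \<alpha> \<longleftrightarrow>
    (\<forall>Z\<in>vector_fields A. \<alpha> Z \<in> smooth_funs A) \<and>
    (\<forall>Y\<in>vector_fields A. \<forall>Z\<in>vector_fields A. \<alpha> (Y + Z) = \<alpha> Y + \<alpha> Z) \<and>
    (\<forall>f\<in>smooth_funs A. \<forall>Z\<in>vector_fields A. \<alpha> (mult_field f Z) = f * \<alpha> Z)"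

lemma smooth_formD:
  assumes "smooth_form \<alpha>"
  shows "Z \<in> vector_fields A \<Longrightarrow> \<alpha> Z \<in> smooth_funs A"
    and "Y \<in> vector_fields A \<Longrightarrow> Z \<in> vector_fields A \<Longrightarrow> \<alpha> (Y + Z) = \<alpha> Y + \<alpha> Z"
    and "f \<in> smooth_funs A \<Longrightarrow> Z \<in> vector_fields A \<Longrightarrow> \<alpha> (mult_field f Z) = f * \<alpha> Z"
  using assms unfolding smooth_form_def by blast+

lemma smooth_form_zero:
  assumes "smooth_form \<alpha>"
  shows "\<alpha> 0 = 0"
  using smooth_formD(2)[OF assms, of 0 0] by simp

lemma smooth_form_sum:
  assumes "smooth_form \<alpha>" "\<And>b. b \<in> N \<Longrightarrow> F b \<in> vector_fields A"
  shows "\<alpha> (\<Sum>b\<in>N. F b) = (\<Sum>b\<in>N. \<alpha> (F b))"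
  using assms(2)
  by (induction N rule: infinite_finite_induct)
     (simp_all add: smooth_form_zero[OF assms(1)] smooth_formD(2)[OF assms(1)])

lemma smooth_form_lincomb:
  assumes "smooth_form \<alpha>" "\<And>b. b \<in> N \<Longrightarrow> c b \<in> smooth_funs A" "\<And>b. b \<in> N \<Longrightarrow> E b \<in> vector_fields A"
  shows "\<alpha> (\<Sum>b\<in>N. mult_field (c b) (E b)) = (\<Sum>b\<in>N. c b * \<alpha> (E b))"
  using assms by (subst smooth_form_sum) (auto simp: smooth_formD(3) intro!: sum.cong)

text \<open>Write \<open>Z\<close> near \<open>x\<close> as a combination of a frame with coefficients vanishing at \<open>x\<close>. After
  multiplication with a bump function the identity is global, and linearity over smooth functions
  applies to it.\<close>

lemma smooth_form_pointwise:
  assumes \<alpha>: "smooth_form \<alpha>" and Z: "Z \<in> vector_fields A" and "Z x = 0"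
  shows "\<alpha> Z x = 0"
proof -
  obtain N E where N: "finite N" and E [rule_format]: "\<forall>b\<in>N. E b \<in> vector_fields A"
    and fr: "\<forall>\<^sub>F y in nhds x. frame_at N E y"
    by (rule frame_fields_near)
  obtain c where c [rule_format]: "\<forall>b\<in>N. smooth_near A x (c b)"
    and Z_eq: "\<forall>\<^sub>F y in nhds x. Z y = (\<Sum>b\<in>N. c b y *\<^sub>R E b y)"
    by (rule coefficients_near[OF N E fr Z])
  have "(\<Sum>b\<in>N. c b x *\<^sub>R E b x) = 0"
    using eventually_nhds_x_imp_x[OF Z_eq] assms(3) by simp
  then have cx: "c b x = 0" if "b \<in> N" for b
    using frame_at_independent[OF eventually_nhds_x_imp_x[OF fr], of "\<lambda>b. c b x"] that by blast
  obtain \<beta> where \<beta> [rule_format]: "\<beta> \<in> smooth_funs A" "\<beta> x \<noteq> 0"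
      "\<forall>y. \<beta> y \<noteq> 0 \<longrightarrow> Z y = (\<Sum>b\<in>N. c b y *\<^sub>R E b y)" "\<forall>b\<in>N. \<beta> * c b \<in> smooth_funs A"
    by (rule smooth_cutoff[OF N c Z_eq])
  have "mult_field \<beta> Z = (\<Sum>b\<in>N. mult_field (\<beta> * c b) (E b))"
  proof
    fix y
    show "mult_field \<beta> Z y = (\<Sum>b\<in>N. mult_field (\<beta> * c b) (E b)) y"
      using \<beta>(3)[of y]
      by (cases "\<beta> y = 0") (simp_all add: mult_field_apply sum_fun_apply[of _ N y] scaleR_sum_right)
  qed
  then have "\<beta> * \<alpha> Z = (\<Sum>b\<in>N. \<beta> * c b * \<alpha> (E b))"
    using smooth_formD(3)[OF \<alpha> \<beta>(1) Z]
      smooth_form_lincomb[OF \<alpha>, of N "\<lambda>b. \<beta> * c b" E, OF \<beta>(4) E] by simp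
  then have "\<beta> x * \<alpha> Z x = (\<Sum>b\<in>N. \<beta> * c b * \<alpha> (E b)) x"
    by (metis times_fun_apply)
  also have "\<dots> = 0" by (simp add: sum_fun_apply cx)
  finally show ?thesis using \<beta>(2) by simp
qed

lemma vector_field_through:
  assumes "v \<in> tangent_space A x"
  obtains Z where "Z \<in> vector_fields A" "Z x = v"
proof -
  obtain N E where N: "finite N" and E [rule_format]: "\<forall>b\<in>N. E b \<in> vector_fields A"
    and fr: "\<forall>\<^sub>F y in nhds x. frame_at N E y"
    by (rule frame_fields_near)
  obtain c where "v = (\<Sum>b\<in>N. c b *\<^sub>R E b x)"
    using eventually_nhds_x_imp_x[OF fr] assms unfolding frame_at_def by blast
  then show ?thesis
    using E by (intro that[of "\<Sum>b\<in>N. c b *\<^sub>R E b"]) (auto simp: sum_fun_apply[of _ N x])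
qed

lemma metric_fun_separates:
  assumes "W \<in> vector_fields A" "\<And>Z. Z \<in> vector_fields A \<Longrightarrow> metric_fun g W Z = 0"
  shows "W = 0"
proof
  fix x
  have "g x (W x) v = 0" if "v \<in> tangent_space A x" for v
    using vector_field_through[OF that] assms(2) by (metis metric_fun_def zero_fun_apply)
  then show "W x = 0 x"
    using g_nondegenerate[of "W x" x] assms(1) by simp
qed

text \<open>The form has a pointwise value on tangent vectors, and near each point the solution of the Gram
  system represents it. These local solutions agree because \<open>g\<close> is non-degenerate, so they
  glue to a smooth field.\<close>

lemma smooth_form_represented:
  assumes \<alpha>: "smooth_form \<alpha>"
  shows "\<exists>W\<in>vector_fields A. \<forall>Z\<in>vector_fields A. metric_fun g W Z = \<alpha> Z"
proof -
  define P where "P x w \<longleftrightarrow> w \<in> tangent_space A x \<and> (\<forall>Z\<in>vector_fields A. g x w (Z x) = \<alpha> Z x)" for x w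
  have P_unique: "w = w'" if "P x w" "P x w'" for x w w'
  proof -
    have "w - w' = 0"
    proof (rule g_nondegenerate)
      show "w - w' \<in> tangent_space A x" using that by (simp add: P_def)
      fix v assume v: "v \<in> tangent_space A x"
      then obtain Z where "Z \<in> vector_fields A" "Z x = v" by (rule vector_field_through)
      then show "g x (w - w') v = 0" using that v by (auto simp: P_def g_diff_left)
    qed
    then show ?thesis by simp
  qed
  have local: "\<exists>(N :: (int \<times> nat) set) c E. (\<forall>b\<in>N. E b \<in> vector_fields A \<and> smooth_near A x (c b)) \<and>
      (\<forall>\<^sub>F y in nhds x. P y (\<Sum>b\<in>N. c b y *\<^sub>R E b y))" for x
  proof -
    obtain N E where N: "finite N" and E [rule_format]: "\<forall>b\<in>N. E b \<in> vector_fields A"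
      and fr: "\<forall>\<^sub>F y in nhds x. frame_at N E y"
      by (rule frame_fields_near)
    obtain c where c [rule_format]: "\<forall>b\<in>N. smooth_near A x (c b)"
      and c_eq: "\<forall>\<^sub>F y in nhds x. \<forall>b\<in>N. g y (\<Sum>a\<in>N. c a y *\<^sub>R E a y) (E b y) = \<alpha> (E b) y"
      by (rule riesz_near[OF N E fr smooth_funs_near[OF smooth_formD(1)[OF \<alpha> E]]])
    have "\<forall>\<^sub>F y in nhds x. P y (\<Sum>b\<in>N. c b y *\<^sub>R E b y)"
      using c_eq fr
    proof eventually_elim
      case (elim y)
      let ?w = "\<Sum>b\<in>N. c b y *\<^sub>R E b y"
      have w: "?w \<in> tangent_space A y" using E by simp
      have "g y ?w (Z y) = \<alpha> Z y" if Z: "Z \<in> vector_fields A" for Z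
      proof -
        obtain e where e: "Z y = (\<Sum>b\<in>N. e b *\<^sub>R E b y)"
          using elim(2) Z unfolding frame_at_def by (meson vector_field_at)
        \<comment> \<open>a field with constant coefficients in the frame that agrees with \<open>Z\<close> at \<open>y\<close>\<close>
        define Z' where "Z' = (\<Sum>b\<in>N. mult_field (\<lambda>_. e b) (E b))"
        have Z': "Z' \<in> vector_fields A" "Z' y = Z y"
          using E e by (simp_all add: Z'_def sum_fun_apply[of _ N y] mult_field_apply)
        have "\<alpha> Z' + \<alpha> (Z - Z') = \<alpha> Z"
          using smooth_formD(2)[OF \<alpha> Z'(1), of "Z - Z'"] Z Z'(1) by simp
        moreover have "\<alpha> (Z - Z') y = 0"
          using Z Z' by (intro smooth_form_pointwise[OF \<alpha>]) auto
        ultimately have "\<alpha> Z y = \<alpha> Z' y"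
          by (metis add.right_neutral plus_fun_apply)
        also have "\<alpha> Z' y = (\<Sum>b\<in>N. e b * \<alpha> (E b) y)"
          unfolding Z'_def using smooth_form_lincomb[OF \<alpha>, of N "\<lambda>b _. e b" E] E
          by (simp add: sum_fun_apply)
        also have "\<dots> = g y ?w (Z y)"
          using elim(1) E w by (simp add: e g_sum_right)
        finally show ?thesis by simp
      qed
      then show ?case using w by (simp add: P_def)
    qed
    then show ?thesis using E c by blast
  qed
  define W where "W x = (SOME w. P x w)" for x
  have P_W: "P x (W x)" for x
    unfolding W_def using local[of x] eventually_nhds_x_imp_x by (metis (mono_tags, lifting) someI_ex)
  have "W \<in> vector_fields A"
  proof (rule vector_field_locally_lincomb)
    show "W x \<in> tangent_space A x" for x using P_W by (simp add: P_def)
    fix x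
    obtain N :: "(int \<times> nat) set" and c E where *: "\<forall>b\<in>N. E b \<in> vector_fields A \<and> smooth_near A x (c b)"
      and ev: "\<forall>\<^sub>F y in nhds x. P y (\<Sum>b\<in>N. c b y *\<^sub>R E b y)"
      using local by blast
    have "\<forall>\<^sub>F y in nhds x. W y = (\<Sum>b\<in>N. c b y *\<^sub>R E b y)"
      using ev by eventually_elim (rule P_unique[OF P_W])
    then show "\<exists>(N :: (int \<times> nat) set) c E. (\<forall>b\<in>N. E b \<in> vector_fields A \<and> smooth_near A x (c b)) \<and>
      (\<forall>\<^sub>F y in nhds x. W y = (\<Sum>b\<in>N. c b y *\<^sub>R E b y))"
      using * by blast
  qed
  moreover have "metric_fun g W Z = \<alpha> Z" if "Z \<in> vector_fields A" for Z
    using P_W that by (auto simp: P_def metric_fun_def)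
  ultimately show ?thesis by blast
qed

section \<open>Projections, the metric on vector fields, and the musical isomorphism\<close>

abbreviation P :: "int \<Rightarrow> 'm field \<Rightarrow> 'm field"
  where "P \<equiv> proj I V"

abbreviation gf :: "'m field \<Rightarrow> 'm field \<Rightarrow> 'm \<Rightarrow> real"
  where "gf \<equiv> metric_fun g"

lemma section_at: "X \<in> sections A (V i) \<Longrightarrow> X x \<in> V i x"
  unfolding sections_def by blast

lemma sectionI: "X \<in> vector_fields A \<Longrightarrow> (\<And>x. X x \<in> V i x) \<Longrightarrow> X \<in> sections A (V i)"
  unfolding sections_def by blast

lemma proj_at:
  assumes "X \<in> vector_fields A" "is_decomp I (\<lambda>i. V i x) (X x) u"
  shows "P k X x = u k"
proof -
  have "(THE u. is_decomp I (\<lambda>i. V i x) (X x) u) = u"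
    by (rule the_equality[where P = "is_decomp I (\<lambda>i. V i x) (X x)", OF assms(2)])
       (rule decomp_unique[OF vector_field_at[OF assms(1)] _ assms(2)])
  then show ?thesis by (simp add: proj_def)
qed

lemma is_decomp_proj:
  assumes "X \<in> vector_fields A"
  shows "is_decomp I (\<lambda>i. V i x) (X x) (\<lambda>k. P k X x)"
proof -
  obtain u where u: "is_decomp I (\<lambda>i. V i x) (X x) u"
    using decomp[OF vector_field_at[OF assms]] by blast
  have "(\<lambda>k. P k X x) = u"
    using proj_at[OF assms u] by (rule ext)
  then show ?thesis using u by simp
qed

lemma proj_in_fibre: "X \<in> vector_fields A \<Longrightarrow> k \<in> I \<Longrightarrow> P k X x \<in> V k x"
  using is_decomp_proj unfolding is_decomp_def by blast

lemma sum_proj: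
  assumes "X \<in> vector_fields A"
  shows "(\<Sum>k\<in>I. P k X) = X"
  using is_decomp_proj[OF assms] by (simp add: fun_eq_iff[of "sum _ _"] sum_fun_apply is_decomp_def)

lemma proj_eqI:
  assumes "X \<in> vector_fields A" "\<And>i x. i \<in> I \<Longrightarrow> F i x \<in> V i x" "X = (\<Sum>i\<in>I. F i)" "k \<in> I"
  shows "P k X = F k"
proof
  fix x
  have "is_decomp I (\<lambda>i. V i x) (X x) (\<lambda>i. if i \<in> I then F i x else 0)"
    using is_decomp_sum[of "\<lambda>i. F i x" x] assms(2,3) by (simp add: sum_fun_apply[of F I x])
  from proj_at[OF assms(1) this] assms(4) show "P k X x = F k x" by simp
qed

text \<open>In an adapted frame the projection keeps the coordinates with first index \<open>k\<close> and drops the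
  others.\<close>

lemma proj_closed [simp]:
  assumes X: "X \<in> vector_fields A" and k: "k \<in> I"
  shows "P k X \<in> vector_fields A"
proof (rule vector_field_locally_lincomb)
  show "P k X x \<in> tangent_space A x" for x
    using fibre_tangent[OF k proj_in_fibre[OF X k]] .
  fix x
  obtain N E where N: "finite N" and N_I [rule_format]: "\<forall>b\<in>N. fst b \<in> I"
    and E [rule_format]: "\<forall>b\<in>N. E b \<in> sections A (V (fst b))" and fr: "\<forall>\<^sub>F y in nhds x. frame_at N E y"
    by (rule frame_near)
  have E': "E b \<in> vector_fields A" if "b \<in> N" for b
    using section_vector_field[OF E[OF that]] .
  obtain c where c [rule_format]: "\<forall>b\<in>N. smooth_near A x (c b)"
    and X_eq: "\<forall>\<^sub>F y in nhds x. X y = (\<Sum>b\<in>N. c b y *\<^sub>R E b y)"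
    by (rule coefficients_near[OF N E' fr X])
  define N' where "N' = {b \<in> N. fst b = k}"
  have "\<forall>\<^sub>F y in nhds x. P k X y = (\<Sum>b\<in>N'. c b y *\<^sub>R E b y)"
    using X_eq
  proof eventually_elim
    case (elim y)
    define F where "F i = (\<Sum>b\<in>{b \<in> N. fst b = i}. c b y *\<^sub>R E b y)" for i
    have "F i \<in> V i y" if i: "i \<in> I" for i
      unfolding F_def
    proof (rule fibre_sum[OF i])
      fix b assume "b \<in> {b \<in> N. fst b = i}"
      then have "E b y \<in> V i y" using section_at[OF E[of b], of y] by simp
      then show "c b y *\<^sub>R E b y \<in> V i y" by (rule fibre_scaleR[OF i])
    qed
    moreover have "(\<Sum>i\<in>I. F i) = X y"
      unfolding F_def elim by (rule sum.group) (use N N_I in auto)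
    ultimately have "is_decomp I (\<lambda>i. V i y) (X y) (\<lambda>i. if i \<in> I then F i else 0)"
      using is_decomp_sum[of F y] by simp
    from proj_at[OF X this] k show ?case by (simp add: F_def N'_def)
  qed
  then show "\<exists>(N :: (int \<times> nat) set) c E. (\<forall>b\<in>N. E b \<in> vector_fields A \<and> smooth_near A x (c b)) \<and>
      (\<forall>\<^sub>F y in nhds x. P k X y = (\<Sum>b\<in>N. c b y *\<^sub>R E b y))"
    using E' c by (intro exI[of _ N'] exI[of _ c] exI[of _ E]) (auto simp: N'_def)
qed

lemma proj_section [simp]: "X \<in> vector_fields A \<Longrightarrow> k \<in> I \<Longrightarrow> P k X \<in> sections A (V k)"
  by (intro sectionI proj_closed proj_in_fibre)

lemma proj_of_section:
  assumes X: "X \<in> sections A (V i)" and "i \<in> I" "k \<in> I"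
  shows "P k X = (if k = i then X else 0)"
proof (rule proj_eqI[of X "\<lambda>k. if k = i then X else 0" k])
  show "(if j = i then X else 0) x \<in> V j x" if "j \<in> I" for j x
    using section_at[OF X] that by auto
  show "X = (\<Sum>j\<in>I. if j = i then X else 0)" using \<open>i \<in> I\<close> by simp
qed (use X \<open>k \<in> I\<close> in auto)

lemma proj_proj:
  "X \<in> vector_fields A \<Longrightarrow> i \<in> I \<Longrightarrow> k \<in> I \<Longrightarrow> P k (P i X) = (if k = i then P i X else 0)"
  by (simp add: proj_of_section)

lemma proj_add:
  assumes X: "X \<in> vector_fields A" and Y: "Y \<in> vector_fields A" and "k \<in> I"
  shows "P k (X + Y) = P k X + P k Y"
proof (rule proj_eqI[of "X + Y" "\<lambda>k. P k X + P k Y"])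
  show "X + Y = (\<Sum>i\<in>I. P i X + P i Y)"
    using sum_proj[OF X] sum_proj[OF Y] by (simp add: sum.distrib)
qed (use assms proj_in_fibre fibre_add in auto)

lemma proj_mult:
  assumes X: "X \<in> vector_fields A" and f: "f \<in> smooth_funs A" and "k \<in> I"
  shows "P k (mult_field f X) = mult_field f (P k X)"
proof (rule proj_eqI[of "mult_field f X" "\<lambda>k. mult_field f (P k X)"])
  have "mult_field f X = mult_field f (\<Sum>i\<in>I. P i X)" using sum_proj[OF X] by simp
  then show "mult_field f X = (\<Sum>i\<in>I. mult_field f (P i X))"
    by (simp add: fun_eq_iff[of "mult_field f X"] mult_field_apply sum_fun_apply[of _ I] scaleR_sum_right)
qed (use assms proj_in_fibre fibre_scaleR in \<open>auto simp: mult_field_apply\<close>)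

lemma proj_zero: "k \<in> I \<Longrightarrow> P k 0 = 0"
  using proj_add[of 0 0 k] by simp

lemma proj_uminus: "X \<in> vector_fields A \<Longrightarrow> k \<in> I \<Longrightarrow> P k (- X) = - P k X"
  using proj_add[of X "- X" k] proj_zero[of k] by (simp add: eq_neg_iff_add_eq_0 add.commute)

lemma proj_sum: "(\<And>a. a \<in> N \<Longrightarrow> F a \<in> vector_fields A) \<Longrightarrow> k \<in> I \<Longrightarrow>
    P k (\<Sum>a\<in>N. F a) = (\<Sum>a\<in>N. P k (F a))"
  by (induction N rule: infinite_finite_induct) (simp_all add: proj_zero proj_add)

lemma gf_commute: "X \<in> vector_fields A \<Longrightarrow> Y \<in> vector_fields A \<Longrightarrow> gf X Y = gf Y X"
  by (simp add: metric_fun_def fun_eq_iff g_commute[of "X _" _ "Y _"])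

lemma gf_add_left: "X \<in> vector_fields A \<Longrightarrow> Y \<in> vector_fields A \<Longrightarrow> Z \<in> vector_fields A \<Longrightarrow>
    gf (X + Y) Z = gf X Z + gf Y Z"
  by (simp add: metric_fun_def fun_eq_iff g_add_left)

lemma gf_mult_left: "X \<in> vector_fields A \<Longrightarrow> Z \<in> vector_fields A \<Longrightarrow> gf (mult_field f X) Z = f * gf X Z"
  by (simp add: metric_fun_def fun_eq_iff mult_field_apply g_scaleR_left)

lemma gf_scaleR_left: "X \<in> vector_fields A \<Longrightarrow> Z \<in> vector_fields A \<Longrightarrow> gf (c *\<^sub>R X) Z = c *\<^sub>R gf X Z"
  by (simp add: metric_fun_def fun_eq_iff g_scaleR_left)

lemma gf_zero_left: "Z \<in> vector_fields A \<Longrightarrow> gf 0 Z = 0"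
  by (simp add: metric_fun_def fun_eq_iff g_zero_left)

lemma gf_diff_left: "X \<in> vector_fields A \<Longrightarrow> Y \<in> vector_fields A \<Longrightarrow> Z \<in> vector_fields A \<Longrightarrow>
    gf (X - Y) Z = gf X Z - gf Y Z"
  by (simp add: metric_fun_def fun_eq_iff g_diff_left)

lemma gf_uminus_left: "X \<in> vector_fields A \<Longrightarrow> Z \<in> vector_fields A \<Longrightarrow> gf (- X) Z = - gf X Z"
  using gf_diff_left[of 0 X Z] by (simp add: gf_zero_left)

lemma gf_sum_left: "(\<And>a. a \<in> N \<Longrightarrow> F a \<in> vector_fields A) \<Longrightarrow> Z \<in> vector_fields A \<Longrightarrow>
    gf (\<Sum>a\<in>N. F a) Z = (\<Sum>a\<in>N. gf (F a) Z)"
  by (induction N rule: infinite_finite_induct) (simp_all add: gf_zero_left gf_add_left)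

lemma gf_add_right: "X \<in> vector_fields A \<Longrightarrow> Y \<in> vector_fields A \<Longrightarrow> Z \<in> vector_fields A \<Longrightarrow>
    gf Z (X + Y) = gf Z X + gf Z Y"
  using gf_add_left[of X Y Z] gf_commute[of Z "X + Y"] gf_commute[of Z X] gf_commute[of Z Y] by simp

lemma gf_mult_right: "X \<in> vector_fields A \<Longrightarrow> Z \<in> vector_fields A \<Longrightarrow> f \<in> smooth_funs A \<Longrightarrow>
    gf Z (mult_field f X) = f * gf Z X"
  using gf_mult_left[of X Z f] gf_commute[of Z "mult_field f X"] gf_commute[of Z X] by simp

lemma gf_zero_right: "Z \<in> vector_fields A \<Longrightarrow> gf Z 0 = 0"
  using gf_zero_left[of Z] gf_commute[of Z 0] by simp

lemma gf_diff_right: "X \<in> vector_fields A \<Longrightarrow> Y \<in> vector_fields A \<Longrightarrow> Z \<in> vector_fields A \<Longrightarrow>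
    gf Z (X - Y) = gf Z X - gf Z Y"
  using gf_diff_left[of X Y Z] gf_commute[of Z "X - Y"] gf_commute[of Z X] gf_commute[of Z Y] by simp

lemma gf_uminus_right: "X \<in> vector_fields A \<Longrightarrow> Z \<in> vector_fields A \<Longrightarrow> gf Z (- X) = - gf Z X"
  using gf_diff_right[of 0 X Z] by (simp add: gf_zero_right)

lemma gf_sum_right: "(\<And>a. a \<in> N \<Longrightarrow> F a \<in> vector_fields A) \<Longrightarrow> Z \<in> vector_fields A \<Longrightarrow>
    gf Z (\<Sum>a\<in>N. F a) = (\<Sum>a\<in>N. gf Z (F a))"
  by (induction N rule: infinite_finite_induct) (simp_all add: gf_zero_right gf_add_right)

lemma gf_eqI:
  assumes "X \<in> vector_fields A" "Y \<in> vector_fields A" "\<And>Z. Z \<in> vector_fields A \<Longrightarrow> gf X Z = gf Y Z"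
  shows "X = Y"
  using metric_fun_separates[of "X - Y"] assms by (simp add: gf_diff_left)

lemma gf_sections:
  assumes "X \<in> sections A (V i)" "Y \<in> sections A (V j)" "i \<in> I" "j \<in> I" "j \<noteq> d i"
  shows "gf X Y = 0"
proof
  show "gf X Y x = 0 x" for x
    using orthogonal[OF assms(3-5) section_at[OF assms(1)] section_at[OF assms(2)]]
    by (simp add: metric_fun_def)
qed

text \<open>Both sides equal the product of the component of \<open>X\<close> in \<open>V k\<close> with that of \<open>Y\<close> in \<open>V (d k)\<close>.\<close>

lemma gf_proj_adjoint:
  assumes X: "X \<in> vector_fields A" and Y: "Y \<in> vector_fields A" and k: "k \<in> I"
  shows "gf (P k X) Y = gf X (P (d k) Y)"
proof -
  have "gf (P k X) Y = gf (P k X) (\<Sum>l\<in>I. P l Y)" using sum_proj[OF Y] by simp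
  also have "\<dots> = (\<Sum>l\<in>I. gf (P k X) (P l Y))" using X Y k by (intro gf_sum_right) auto
  also have "\<dots> = (\<Sum>l\<in>I. if l = d k then gf (P k X) (P (d k) Y) else 0)"
    using X Y k by (intro sum.cong) (auto intro!: gf_sections[OF proj_section proj_section])
  also have "\<dots> = gf (P k X) (P (d k) Y)" using k by simp
  finally have 1: "gf (P k X) Y = gf (P k X) (P (d k) Y)" .
  have dk: "d k = d l \<Longrightarrow> l = k" if "l \<in> I" for l using that k dual_dual by metis
  have "gf X (P (d k) Y) = gf (\<Sum>l\<in>I. P l X) (P (d k) Y)" using sum_proj[OF X] by simp
  also have "\<dots> = (\<Sum>l\<in>I. gf (P l X) (P (d k) Y))" using X Y k by (intro gf_sum_left) auto
  also have "\<dots> = (\<Sum>l\<in>I. if l = k then gf (P k X) (P (d k) Y) else 0)"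
    using X Y k dk by (intro sum.cong refl) (auto intro!: gf_sections[OF proj_section proj_section])
  also have "\<dots> = gf (P k X) (P (d k) Y)" using k by simp
  finally show ?thesis using 1 by simp
qed

lemma sharp_eq:
  assumes "W \<in> vector_fields A" "\<And>Z. Z \<in> vector_fields A \<Longrightarrow> gf W Z = \<alpha> Z"
  shows "sharp A g \<alpha> = W"
  unfolding sharp_def
proof (rule the_equality)
  fix W' assume W': "W' \<in> vector_fields A \<and> (\<forall>Z\<in>vector_fields A. gf W' Z = \<alpha> Z)"
  then show "W' = W" using assms by (intro gf_eqI) auto
qed (use assms in blast)

lemma sharp_closed [simp]: "smooth_form \<alpha> \<Longrightarrow> sharp A g \<alpha> \<in> vector_fields A"
  and gf_sharp: "smooth_form \<alpha> \<Longrightarrow> Z \<in> vector_fields A \<Longrightarrow> gf (sharp A g \<alpha>) Z = \<alpha> Z"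
proof -
  assume "smooth_form \<alpha>"
  from smooth_form_represented[OF this] obtain W where W: "W \<in> vector_fields A" "\<forall>Z\<in>vector_fields A. gf W Z = \<alpha> Z"
    by blast
  then have *: "sharp A g \<alpha> = W" by (intro sharp_eq) auto
  show "sharp A g \<alpha> \<in> vector_fields A" using * W by simp
  show "gf (sharp A g \<alpha>) Z = \<alpha> Z" if "Z \<in> vector_fields A" using * W that by simp
qed

lemma smooth_form_add: "smooth_form \<alpha> \<Longrightarrow> smooth_form \<beta> \<Longrightarrow> smooth_form (\<alpha> + \<beta>)"
  unfolding smooth_form_def by (simp add: algebra_simps)

lemma smooth_form_differential: "f \<in> smooth_funs A \<Longrightarrow> smooth_form (differential f)"
  unfolding smooth_form_def differential_def by (simp add: dir_deriv_field_simps)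

lemma lie_derivative_flat:
  "lie_derivative X (flat g Y) Z = dir_deriv X (gf Y Z) - gf Y (lie_bracket X Z)"
  by (simp add: lie_derivative_def flat_def)

lemma smooth_form_lie_derivative:
  "X \<in> vector_fields A \<Longrightarrow> Y \<in> vector_fields A \<Longrightarrow> smooth_form (lie_derivative X (flat g Y))"
  unfolding smooth_form_def lie_derivative_flat
  by (simp add: gf_add_right gf_mult_right dir_deriv_fun_simps lie_bracket_add_right
      lie_bracket_mult_right algebra_simps)

section \<open>The canonical connection\<close>

lemmas gf_linear = gf_add_left gf_add_right gf_diff_left gf_diff_right gf_uminus_left gf_uminus_right
  gf_mult_left gf_mult_right gf_zero_left gf_zero_right

lemmas lie_bracket_linear = lie_bracket_add_left lie_bracket_add_right
  lie_bracket_mult_left lie_bracket_mult_right lie_bracket_zero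

text \<open>Twice the product of \<open>Z\<close> with the Levi-Civita derivative of \<open>Y\<close> along \<open>X\<close>.\<close>

definition koszul :: "'m field \<Rightarrow> 'm field \<Rightarrow> 'm field \<Rightarrow> 'm \<Rightarrow> real"
  where "koszul X Y Z = dir_deriv X (gf Y Z) + dir_deriv Y (gf X Z) - dir_deriv Z (gf X Y)
    + gf (lie_bracket X Y) Z - gf (lie_bracket X Z) Y - gf (lie_bracket Y Z) X"

lemma koszul_smooth [simp]:
  "X \<in> vector_fields A \<Longrightarrow> Y \<in> vector_fields A \<Longrightarrow> Z \<in> vector_fields A \<Longrightarrow> koszul X Y Z \<in> smooth_funs A"
  unfolding koszul_def by simp

lemma koszul_add:
  assumes "X \<in> vector_fields A" "Y \<in> vector_fields A" "Z \<in> vector_fields A" "W \<in> vector_fields A"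
  shows "koszul (X + W) Y Z = koszul X Y Z + koszul W Y Z"
    and "koszul X (Y + W) Z = koszul X Y Z + koszul X W Z"
    and "koszul X Y (Z + W) = koszul X Y Z + koszul X Y W"
  using assms
  by (simp_all add: koszul_def gf_linear lie_bracket_linear dir_deriv_field_simps dir_deriv_fun_simps)

lemma koszul_zero:
  assumes "X \<in> vector_fields A" "Y \<in> vector_fields A"
  shows "koszul X 0 Y = 0" "koszul X Y 0 = 0"
  using koszul_add(2)[of X 0 Y 0] koszul_add(3)[of X Y 0 0] assms by simp_all

lemma koszul_mult:
  assumes "X \<in> vector_fields A" "Y \<in> vector_fields A" "Z \<in> vector_fields A" "f \<in> smooth_funs A"
  shows "koszul (mult_field f X) Y Z = f * koszul X Y Z"
    and "koszul X (mult_field f Y) Z = f * koszul X Y Z + (dir_deriv X f * gf Y Z + dir_deriv X f * gf Y Z)"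
    and "koszul X Y (mult_field f Z) = f * koszul X Y Z"
  using assms gf_commute[of Y X] gf_commute[of Z Y] gf_commute[of Z X]
  by (simp_all add: koszul_def gf_linear lie_bracket_linear dir_deriv_field_simps
      dir_deriv_fun_simps algebra_simps)

lemma koszul_skew:
  assumes "X \<in> vector_fields A" "Y \<in> vector_fields A" "Z \<in> vector_fields A"
  shows "koszul X Y Z + koszul X Z Y = dir_deriv X (gf Y Z) + dir_deriv X (gf Y Z)"
proof -
  have "gf (lie_bracket Z Y) X = - gf (lie_bracket Y Z) X"
    using assms by (subst lie_bracket_commute) (simp add: gf_uminus_left)
  then show ?thesis
    using gf_commute[OF assms(2,3)] by (simp add: koszul_def)
qed

lemma koszul_torsion:
  assumes "X \<in> vector_fields A" "Y \<in> vector_fields A" "Z \<in> vector_fields A"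
  shows "koszul X Y Z - koszul Y X Z = gf (lie_bracket X Y) Z + gf (lie_bracket X Y) Z"
proof -
  have "gf (lie_bracket Y X) Z = - gf (lie_bracket X Y) Z"
    using assms by (subst lie_bracket_commute) (simp add: gf_uminus_left)
  then show ?thesis
    using gf_commute[OF assms(1,2)] by (simp add: koszul_def)
qed

text \<open>The part of \<open>X\<close> that is orthogonal to both \<open>V j\<close> and \<open>V (d j)\<close>.\<close>

definition far :: "int \<Rightarrow> 'm field \<Rightarrow> 'm field"
  where "far j X = (\<Sum>i\<in>I - {j, d j}. P i X)"

lemma far_closed [simp]: "X \<in> vector_fields A \<Longrightarrow> far j X \<in> vector_fields A"
  unfolding far_def by (intro vector_fields_sum proj_closed) auto

lemma far_add: "X \<in> vector_fields A \<Longrightarrow> Y \<in> vector_fields A \<Longrightarrow> far j (X + Y) = far j X + far j Y"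
  by (simp add: far_def proj_add sum.distrib)

lemma far_mult:
  assumes "X \<in> vector_fields A" "f \<in> smooth_funs A"
  shows "far j (mult_field f X) = mult_field f (far j X)"
proof -
  have "far j (mult_field f X) = (\<Sum>i\<in>I - {j, d j}. mult_field f (P i X))"
    unfolding far_def using assms by (intro sum.cong) (auto simp: proj_mult)
  then show ?thesis
    by (simp add: far_def fun_eq_iff mult_field_apply sum_fun_apply scaleR_sum_right sum_distrib_left)
qed

lemma far_dual: "j \<in> I \<Longrightarrow> far (d j) X = far j X"
  by (simp add: far_def insert_commute)

lemma gf_far:
  assumes "X \<in> vector_fields A" "Y \<in> vector_fields A" "j \<in> I"
  shows "gf (P j Y) (far j X) = 0" "gf (P (d j) Y) (far j X) = 0"
proof -
  have "P k (far j X) = 0" if "k \<in> {j, d j}" for k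
  proof -
    have "P k (far j X) = (\<Sum>i\<in>I - {j, d j}. P k (P i X))"
      unfolding far_def using assms that by (intro proj_sum) auto
    also have "\<dots> = 0" using assms that by (intro sum.neutral) (auto simp: proj_proj)
    finally show ?thesis .
  qed
  then show "gf (P j Y) (far j X) = 0" "gf (P (d j) Y) (far j X) = 0"
    using assms by (simp_all add: gf_proj_adjoint gf_zero_right)
qed

lemma far_section:
  assumes "X \<in> sections A (V i)" "i \<in> I"
  shows "far j X = (if i \<in> {j, d j} then 0 else X)"
proof -
  have "far j X = (\<Sum>k\<in>I - {j, d j}. if k = i then X else 0)"
    unfolding far_def using assms by (intro sum.cong) (auto simp: proj_of_section)
  then show ?thesis using assms(2) by simp
qed

text \<open>Twice the product of \<open>Z\<close> with the derivative of the component of \<open>Y\<close> in \<open>V j\<close>. The first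
  summand is the Levi-Civita derivative followed by the projection to \<open>V j\<close>. For \<open>X\<close> in the part
  \<open>far j X\<close> the Koszul expression contains the term \<open>- gf [Y\<^sub>j, Z] X\<close>, which is absent from the
  derivative that the torsion prescribes; the second summand cancels it. The correction is tensorial, and skew in \<open>Y\<close> and \<open>Z\<close>, so
  neither the Leibniz rule nor compatibility with the metric is affected.\<close>

definition conn_term :: "int \<Rightarrow> 'm field \<Rightarrow> 'm field \<Rightarrow> 'm field \<Rightarrow> 'm \<Rightarrow> real"
  where "conn_term j X Y Z =
    koszul X (P j Y) (P (d j) Z) + gf (lie_bracket (P j Y) (P (d j) Z)) (far j X)"

abbreviation half :: "'m \<Rightarrow> real"
  where "half \<equiv> \<lambda>_. 1 / 2"

text \<open>The factor is a function and not a real scalar, so that all computations take place in the ring of functions.\<close>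

definition conn_form :: "'m field \<Rightarrow> 'm field \<Rightarrow> 'm one_form"
  where "conn_form X Y = (\<lambda>Z. half * (\<Sum>j\<in>I. conn_term j X Y Z))"

lemma half_double: "half * (f + f) = f"
  by (simp add: fun_eq_iff)

lemma conn_term_smooth [simp]:
  "X \<in> vector_fields A \<Longrightarrow> Y \<in> vector_fields A \<Longrightarrow> Z \<in> vector_fields A \<Longrightarrow> j \<in> I \<Longrightarrow>
    conn_term j X Y Z \<in> smooth_funs A"
  unfolding conn_term_def by simp

lemma conn_term_add:
  assumes "X \<in> vector_fields A" "Y \<in> vector_fields A" "Z \<in> vector_fields A" "W \<in> vector_fields A" "j \<in> I"
  shows "conn_term j (X + W) Y Z = conn_term j X Y Z + conn_term j W Y Z"
    and "conn_term j X (Y + W) Z = conn_term j X Y Z + conn_term j X W Z"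
    and "conn_term j X Y (Z + W) = conn_term j X Y Z + conn_term j X Y W"
  using assms
  by (simp_all add: conn_term_def koszul_add proj_add far_add gf_linear lie_bracket_linear)

lemma conn_term_mult:
  assumes "X \<in> vector_fields A" "Y \<in> vector_fields A" "Z \<in> vector_fields A" "f \<in> smooth_funs A" "j \<in> I"
  shows "conn_term j (mult_field f X) Y Z = f * conn_term j X Y Z"
    and "conn_term j X (mult_field f Y) Z = f * conn_term j X Y Z
      + (dir_deriv X f * gf (P j Y) Z + dir_deriv X f * gf (P j Y) Z)"
    and "conn_term j X Y (mult_field f Z) = f * conn_term j X Y Z"
proof -
  have "gf (P j Y) (P (d j) Z) = gf (P j Y) Z"
    using gf_proj_adjoint[of "P j Y" Z j] assms by (simp add: proj_proj)
  then show "conn_term j X (mult_field f Y) Z = f * conn_term j X Y Z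
      + (dir_deriv X f * gf (P j Y) Z + dir_deriv X f * gf (P j Y) Z)"
    using assms by (simp add: conn_term_def koszul_mult proj_mult gf_linear lie_bracket_linear gf_far
        algebra_simps)
qed (use assms in \<open>simp_all add: conn_term_def koszul_mult proj_mult far_mult gf_linear
    lie_bracket_linear gf_far algebra_simps\<close>)

lemma conn_term_skew:
  assumes "X \<in> vector_fields A" "Y \<in> vector_fields A" "Z \<in> vector_fields A" "j \<in> I"
  shows "conn_term j X Y Z + conn_term (d j) X Z Y =
    dir_deriv X (gf (P j Y) Z) + dir_deriv X (gf (P j Y) Z)"
proof -
  have 1: "gf (lie_bracket (P (d j) Z) (P j Y)) (far j X) =
      - gf (lie_bracket (P j Y) (P (d j) Z)) (far j X)"
    using assms by (subst lie_bracket_commute) (simp add: gf_uminus_left)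
  have 2: "gf (P j Y) (P (d j) Z) = gf (P j Y) Z"
    using gf_proj_adjoint[of "P j Y" Z j] assms by (simp add: proj_proj)
  show ?thesis
    using koszul_skew[of X "P j Y" "P (d j) Z"] assms
    by (simp add: conn_term_def far_dual 1 2)
qed

lemma dir_deriv_sum:
  "X \<in> vector_fields A \<Longrightarrow> (\<And>a. a \<in> N \<Longrightarrow> f a \<in> smooth_funs A) \<Longrightarrow>
    dir_deriv X (\<Sum>a\<in>N. f a) = (\<Sum>a\<in>N. dir_deriv X (f a))"
  by (induction N rule: infinite_finite_induct) (simp_all add: dir_deriv_zero_fun dir_deriv_fun_simps)

lemma sum_gf_proj: "Y \<in> vector_fields A \<Longrightarrow> Z \<in> vector_fields A \<Longrightarrow> (\<Sum>j\<in>I. gf (P j Y) Z) = gf Y Z"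
  using gf_sum_left[of I "\<lambda>j. P j Y" Z] sum_proj[of Y] by simp

lemma conn_form_add:
  assumes "X \<in> vector_fields A" "Y \<in> vector_fields A" "Z \<in> vector_fields A" "W \<in> vector_fields A"
  shows "conn_form (X + W) Y Z = conn_form X Y Z + conn_form W Y Z"
    and "conn_form X (Y + W) Z = conn_form X Y Z + conn_form X W Z"
    and "conn_form X Y (Z + W) = conn_form X Y Z + conn_form X Y W"
  using assms by (simp_all add: conn_form_def conn_term_add sum.distrib distrib_left)

lemma conn_form_mult:
  assumes "X \<in> vector_fields A" "Y \<in> vector_fields A" "Z \<in> vector_fields A" "f \<in> smooth_funs A"
  shows "conn_form (mult_field f X) Y Z = f * conn_form X Y Z"
    and "conn_form X (mult_field f Y) Z = dir_deriv X f * gf Y Z + f * conn_form X Y Z"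
    and "conn_form X Y (mult_field f Z) = f * conn_form X Y Z"
proof -
  let ?G = "dir_deriv X f * gf Y Z"
  have "(\<Sum>j\<in>I. conn_term j X (mult_field f Y) Z) = f * (\<Sum>j\<in>I. conn_term j X Y Z) + (?G + ?G)"
    using assms by (simp add: conn_term_mult sum.distrib sum_distrib_left[symmetric] sum_gf_proj)
  then have "conn_form X (mult_field f Y) Z = f * conn_form X Y Z + half * (?G + ?G)"
    by (simp only: conn_form_def distrib_left mult.left_commute)
  then show "conn_form X (mult_field f Y) Z = ?G + f * conn_form X Y Z"
    unfolding half_double by (simp add: add.commute)
qed (use assms in \<open>simp_all add: conn_form_def conn_term_mult sum_distrib_left[symmetric] mult.left_commute\<close>)

lemma smooth_form_conn_form:
  "X \<in> vector_fields A \<Longrightarrow> Y \<in> vector_fields A \<Longrightarrow> smooth_form (conn_form X Y)"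
  unfolding smooth_form_def by (simp add: conn_form_add conn_form_mult) (simp add: conn_form_def)

text \<open>Exchanging \<open>Y\<close> and \<open>Z\<close> exchanges the contributions of \<open>j\<close> and \<open>d j\<close>, so the second sum is
  reindexed along the involution.\<close>

lemma conn_form_metric:
  assumes "X \<in> vector_fields A" "Y \<in> vector_fields A" "Z \<in> vector_fields A"
  shows "conn_form X Y Z + conn_form X Z Y = dir_deriv X (gf Y Z)"
proof -
  have "(\<Sum>j\<in>I. conn_term j X Z Y) = (\<Sum>j\<in>I. conn_term (d j) X Z Y)"
    by (rule sum.reindex_bij_witness[of I d d]) auto
  then have "(\<Sum>j\<in>I. conn_term j X Y Z) + (\<Sum>j\<in>I. conn_term j X Z Y) =
      (\<Sum>j\<in>I. conn_term j X Y Z + conn_term (d j) X Z Y)"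
    by (simp add: sum.distrib)
  also have "\<dots> = (\<Sum>j\<in>I. dir_deriv X (gf (P j Y) Z) + dir_deriv X (gf (P j Y) Z))"
    using assms by (intro sum.cong) (simp_all add: conn_term_skew)
  also have "\<dots> = dir_deriv X (gf Y Z) + dir_deriv X (gf Y Z)"
  proof -
    have "dir_deriv X (gf Y Z) = (\<Sum>j\<in>I. dir_deriv X (gf (P j Y) Z))"
      using assms dir_deriv_sum[of X I "\<lambda>j. gf (P j Y) Z"] by (simp add: sum_gf_proj)
    then show ?thesis by (simp only: sum.distrib)
  qed
  finally have "half * ((\<Sum>j\<in>I. conn_term j X Y Z) + (\<Sum>j\<in>I. conn_term j X Z Y)) =
      dir_deriv X (gf Y Z)"
    by (simp only: half_double)
  then show ?thesis by (simp only: conn_form_def distrib_left)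
qed

lemma conn_form_section:
  assumes X: "X \<in> vector_fields A" and Y: "Y \<in> sections A (V j)" and Z: "Z \<in> vector_fields A"
    and j: "j \<in> I"
  shows "conn_form X Y Z =
    half * (koszul X Y (P (d j) Z) + gf (lie_bracket Y (P (d j) Z)) (far j X))"
proof -
  have "(\<Sum>l\<in>I. conn_term l X Y Z) = (\<Sum>l\<in>I. if l = j then
      koszul X Y (P (d j) Z) + gf (lie_bracket Y (P (d j) Z)) (far j X) else 0)"
    using assms
    by (intro sum.cong)
       (auto simp: conn_term_def proj_of_section[OF Y j] koszul_zero lie_bracket_zero gf_linear)
  then show ?thesis using j by (simp add: conn_form_def)
qed

text \<open>The bounded abstractions give the default value outside the vector fields that
  \<^const>\<open>affine_connection\<close> asks for.\<close>

definition conn :: "'m field \<Rightarrow> 'm field \<Rightarrow> 'm field"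
  where "conn = (\<lambda>X\<in>vector_fields A. \<lambda>Y\<in>vector_fields A. sharp A g (conn_form X Y))"

lemma conn_closed [simp]:
  "X \<in> vector_fields A \<Longrightarrow> Y \<in> vector_fields A \<Longrightarrow> conn X Y \<in> vector_fields A"
  by (simp add: conn_def smooth_form_conn_form)

lemma gf_conn:
  "X \<in> vector_fields A \<Longrightarrow> Y \<in> vector_fields A \<Longrightarrow> Z \<in> vector_fields A \<Longrightarrow>
    gf (conn X Y) Z = conn_form X Y Z"
  by (simp add: conn_def smooth_form_conn_form gf_sharp)

lemma affine_connection_conn: "affine_connection A conn"
  unfolding affine_connection_def
proof (intro conjI ballI)
  show "conn \<in> vector_fields A \<rightarrow>\<^sub>E vector_fields A \<rightarrow>\<^sub>E vector_fields A"
    unfolding conn_def by (auto simp: smooth_form_conn_form)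
next
  fix X Y Z assume *: "X \<in> vector_fields A" "Y \<in> vector_fields A" "Z \<in> vector_fields A"
  show "conn (X + Y) Z = conn X Z + conn Y Z"
    using * by (intro gf_eqI) (simp_all add: gf_conn gf_add_left conn_form_add)
  show "conn X (Y + Z) = conn X Y + conn X Z"
    using * by (intro gf_eqI) (simp_all add: gf_conn gf_add_left conn_form_add)
next
  fix f X Y assume *: "f \<in> smooth_funs A" "X \<in> vector_fields A" "Y \<in> vector_fields A"
  show "conn (mult_field f X) Y = mult_field f (conn X Y)"
    using * by (intro gf_eqI) (simp_all add: gf_conn gf_mult_left conn_form_mult)
  show "conn X (mult_field f Y) = mult_field (dir_deriv X f) Y + mult_field f (conn X Y)"
    using * by (intro gf_eqI) (simp_all add: gf_conn gf_mult_left gf_add_left conn_form_mult)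
qed

lemma metric_connection_conn: "metric_connection A g conn"
  unfolding metric_connection_def
proof (intro ballI)
  fix X Y Z assume *: "X \<in> vector_fields A" "Y \<in> vector_fields A" "Z \<in> vector_fields A"
  have "gf Y (conn X Z) = conn_form X Z Y" using * gf_commute[of Y "conn X Z"] by (simp add: gf_conn)
  then show "dir_deriv X (gf Y Z) = gf (conn X Y) Z + gf Y (conn X Z)"
    using * by (simp add: gf_conn conn_form_metric)
qed

text \<open>For \<open>k \<noteq> i\<close> the product of the component in \<open>V k\<close> with \<open>Z\<close> involves only the component of \<open>Z\<close>
  in \<open>V (d k)\<close>, while \<open>conn_form X Y\<close> sees only that in \<open>V (d i)\<close>.\<close>

lemma conn_section:
  assumes X: "X \<in> vector_fields A" and Y: "Y \<in> sections A (V i)" and i: "i \<in> I"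
  shows "conn X Y \<in> sections A (V i)"
proof -
  have "P k (conn X Y) = 0" if k: "k \<in> I" "k \<noteq> i" for k
  proof (rule metric_fun_separates)
    fix Z assume Z: "Z \<in> vector_fields A"
    have "d i \<noteq> d k" using i k dual_dual by metis
    then have "P (d i) (P (d k) Z) = 0" using i k Z by (simp add: proj_proj)
    then have "conn_form X Y (P (d k) Z) = 0"
      using conn_form_section[OF X Y _ i, of "P (d k) Z"] X Y Z k
      by (simp add: koszul_zero lie_bracket_zero gf_linear)
    then show "gf (P k (conn X Y)) Z = 0"
      using X Y Z k by (simp add: gf_proj_adjoint gf_conn)
  qed (use X Y k in simp)
  then have "(\<Sum>k\<in>I. P k (conn X Y)) = (\<Sum>k\<in>I. if k = i then P i (conn X Y) else 0)"
    by (intro sum.cong) auto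
  then have "conn X Y = P i (conn X Y)"
    using sum_proj[of "conn X Y"] X Y i by simp
  then show ?thesis using proj_section[of "conn X Y" i] X Y i by simp
qed

lemma witt_connection_conn: "witt_connection A g I V conn"
  unfolding witt_connection_def
  using affine_connection_conn metric_connection_conn conn_section by blast

section \<open>Torsion of the canonical connection\<close>

abbreviation hom where "hom \<equiv> witt_tensor_hom A g I d V"

lemma gf_proj_sharp:
  "smooth_form \<alpha> \<Longrightarrow> Z \<in> vector_fields A \<Longrightarrow> k \<in> I \<Longrightarrow> gf (P k (sharp A g \<alpha>)) Z = \<alpha> (P (d k) Z)"
  by (simp add: gf_proj_adjoint gf_sharp)

lemma scaleR_eq_mult: "c *\<^sub>R f = (\<lambda>_. c) * (f :: 'm \<Rightarrow> real)"
  by (simp add: fun_eq_iff)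

lemma differential_apply: "differential f Z = dir_deriv Z f"
  by (simp add: differential_def)

lemmas hom_smooth_forms = smooth_form_add smooth_form_lie_derivative smooth_form_differential

lemma witt_tensor_hom_zero:
  assumes "k \<in> I" "X \<in> vector_fields A"
  shows "hom k i j X 0 = 0" "hom k i j 0 X = 0"
proof -
  have "sharp A g \<alpha> = 0" if "\<And>Z. Z \<in> vector_fields A \<Longrightarrow> \<alpha> Z = 0" for \<alpha>
    using that by (intro sharp_eq) (simp_all add: gf_zero_left)
  then have "sharp A g (lie_derivative X (flat g 0) + lie_derivative 0 (flat g X)) = 0"
    "sharp A g (lie_derivative 0 (flat g X) + lie_derivative X (flat g 0)) = 0"
    "sharp A g (lie_derivative X (flat g 0)) = 0" "sharp A g (lie_derivative 0 (flat g X)) = 0"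
    "sharp A g (differential 0) = 0"
    using assms(2) by (simp_all add: lie_derivative_flat gf_linear lie_bracket_linear
        dir_deriv_field_simps dir_deriv_zero_fun differential_def)
  then show "hom k i j X 0 = 0" "hom k i j 0 X = 0"
    using assms by (simp_all add: witt_tensor_hom_def gf_linear lie_bracket_linear proj_zero)
qed

text \<open>All summands but one have a zero field as an argument.\<close>

lemma witt_tensor_section:
  assumes X: "X \<in> sections A (V i)" and Y: "Y \<in> sections A (V j)" and "i \<in> I" "j \<in> I" "k \<in> I"
  shows "witt_tensor A g I d V k X Y = hom k i j X Y"
proof -
  have "(\<Sum>j'\<in>I. hom k i' j' (P i' X) (P j' Y)) = (if i' = i then hom k i j X Y else 0)"
    if "i' \<in> I" for i'
  proof -
    have "(\<Sum>j'\<in>I. hom k i' j' (P i' X) (P j' Y)) = (\<Sum>j'\<in>I. if j' = j then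
        (if i' = i then hom k i j X Y else 0) else 0)"
      using assms that
      by (intro sum.cong) (auto simp: proj_of_section[OF X] proj_of_section[OF Y] witt_tensor_hom_zero)
    then show ?thesis using assms by simp
  qed
  then have "witt_tensor A g I d V k X Y = (\<Sum>i'\<in>I. if i' = i then hom k i j X Y else 0)"
    unfolding witt_tensor_def by (intro sum.cong) auto
  then show ?thesis using assms by simp
qed

text \<open>This identifies the tensor in the torsion formula. Let \<open>Z'\<close> be the part of \<open>Z\<close> in \<open>V (d j)\<close>. If
  \<open>i = d j\<close>, both sides are half the Koszul expression of \<open>X\<close>, \<open>Y\<close>, \<open>Z'\<close>. Otherwise \<open>X\<close> is
  orthogonal to \<open>Y\<close> and \<open>Z'\<close> and equals \<open>far j X\<close>; the Koszul expression with its correction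
  reduces to the Lie derivative and bracket terms.\<close>

lemma conn_off_diagonal:
  assumes X: "X \<in> sections A (V i)" and Y: "Y \<in> sections A (V j)" and ij: "i \<in> I" "j \<in> I" "i \<noteq> j"
  shows "conn X Y = P j (lie_bracket X Y) + hom j i j X Y"
proof (rule gf_eqI)
  have XY: "X \<in> vector_fields A" "Y \<in> vector_fields A" using X Y by simp_all
  have hom_closed: "hom j i j X Y \<in> vector_fields A"
    using XY ij by (simp add: witt_tensor_hom_def hom_smooth_forms)
  then show "P j (lie_bracket X Y) + hom j i j X Y \<in> vector_fields A" using XY ij by simp
  show "conn X Y \<in> vector_fields A" using XY by simp
  fix Z assume Z: "Z \<in> vector_fields A"
  define Z' where "Z' = P (d j) Z"
  have Z': "Z' \<in> vector_fields A" using Z ij by (simp add: Z'_def)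
  have brackets: "gf Y (lie_bracket X Z') = gf (lie_bracket X Z') Y"
    "gf X (lie_bracket Y Z') = gf (lie_bracket Y Z') X"
    using XY Z' by (simp_all add: gf_commute)
  have lhs: "gf (conn X Y) Z = half * (koszul X Y Z' + gf (lie_bracket Y Z') (far j X))"
    using gf_conn[OF XY Z] conn_form_section[OF XY(1) Y Z ij(2)] by (simp add: Z'_def)
  have rhs: "gf (P j (lie_bracket X Y) + hom j i j X Y) Z =
      gf (lie_bracket X Y) Z' + gf (hom j i j X Y) Z"
    using XY Z ij hom_closed by (simp add: gf_add_left gf_proj_adjoint Z'_def)
  show "gf (conn X Y) Z = gf (P j (lie_bracket X Y) + hom j i j X Y) Z"
  proof (cases "i = d j")
    case True
    have "gf (hom j i j X Y) Z = half * ((dir_deriv X (gf Y Z') - gf Y (lie_bracket X Z'))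
        + (dir_deriv Y (gf X Z') - gf X (lie_bracket Y Z')) - gf (lie_bracket X Y) Z'
        - dir_deriv Z' (gf X Y))"
      using True XY Z ij
      by (simp add: witt_tensor_hom_def gf_scaleR_left gf_diff_left gf_proj_sharp hom_smooth_forms
          gf_proj_adjoint[of "lie_bracket X Y"] lie_derivative_flat differential_apply scaleR_eq_mult
          flip: Z'_def) (simp add: fun_eq_iff)
    moreover have "far j X = 0" using far_section[OF X ij(1)] True by simp
    ultimately show ?thesis
      using XY Z' unfolding lhs rhs brackets
      by (simp add: koszul_def gf_zero_right) (simp add: fun_eq_iff field_simps)
  next
    case False
    have "gf (hom j i j X Y) Z = half * ((dir_deriv X (gf Y Z') - gf Y (lie_bracket X Z'))
        - gf (lie_bracket X Y) Z')"
      using False XY Z ij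
      by (simp add: witt_tensor_hom_def gf_scaleR_left gf_diff_left gf_proj_sharp hom_smooth_forms
          gf_proj_adjoint[of "lie_bracket X Y"] lie_derivative_flat scaleR_eq_mult flip: Z'_def)
        (simp add: fun_eq_iff)
    moreover have "far j X = X" using far_section[OF X ij(1)] False ij(3) by simp
    moreover have "gf X Y = 0"
      using False ij by (intro gf_sections[OF X Y]) auto
    moreover have "gf X Z' = 0"
    proof (rule gf_sections[OF X])
      show "Z' \<in> sections A (V (d j))" using Z ij by (simp add: Z'_def)
      show "d j \<noteq> d i" using ij dual_dual by metis
    qed (use ij in simp_all)
    ultimately show ?thesis
      using XY Z' unfolding lhs rhs brackets
      by (simp add: koszul_def dir_deriv_zero_fun) (simp add: fun_eq_iff field_simps)
  qed
qed

text \<open>Here \<open>far\<close> vanishes, and what remains is the symmetry of the Koszul expression up to the bracket,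
  that is, the vanishing torsion of the Levi-Civita connection.\<close>

lemma conn_diagonal:
  assumes X: "X \<in> sections A (V i)" and Y: "Y \<in> sections A (V i)" and i: "i \<in> I"
  shows "conn X Y - conn Y X = P i (lie_bracket X Y)"
proof (rule gf_eqI)
  have XY: "X \<in> vector_fields A" "Y \<in> vector_fields A" using X Y by simp_all
  then show "conn X Y - conn Y X \<in> vector_fields A" "P i (lie_bracket X Y) \<in> vector_fields A"
    using i by simp_all
  fix Z assume Z: "Z \<in> vector_fields A"
  define Z' where "Z' = P (d i) Z"
  have Z': "Z' \<in> vector_fields A" using Z i by (simp add: Z'_def)
  have "far i X = 0" "far i Y = 0" using far_section[OF X i] far_section[OF Y i] by simp_all
  then have "gf (conn X Y - conn Y X) Z = half * (koszul X Y Z' - koszul Y X Z')"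
    using conn_form_section[OF XY(1) Y Z i] conn_form_section[OF XY(2) X Z i] XY Z Z'
    by (simp add: gf_diff_left gf_conn gf_zero_right right_diff_distrib flip: Z'_def)
  also have "\<dots> = gf (P i (lie_bracket X Y)) Z"
    unfolding koszul_torsion[OF XY Z'] half_double using XY Z i by (simp add: gf_proj_adjoint Z'_def)
  finally show "gf (conn X Y - conn Y X) Z = gf (P i (lie_bracket X Y)) Z" .
qed

lemma torsion_conn:
  assumes X: "X \<in> sections A (V i)" and Y: "Y \<in> sections A (V j)" and ij: "i \<in> I" "j \<in> I"
  shows "torsion conn X Y = - proj_perp I V i j (lie_bracket X Y)
    + witt_tensor A g I d V j X Y - witt_tensor A g I d V i Y X"
proof -
  let ?L = "lie_bracket X Y"
  have L: "?L \<in> vector_fields A" using X Y by simp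
  have tensors: "witt_tensor A g I d V j X Y = hom j i j X Y"
    "witt_tensor A g I d V i Y X = hom i j i Y X"
    using witt_tensor_section X Y ij by simp_all
  show ?thesis
  proof (cases "i = j")
    case True
    have "?L = P i ?L + proj_perp I V i j ?L"
      using sum_proj[OF L] sum.remove[OF finite_I ij(1), of "\<lambda>k. P k ?L"] True
      by (simp add: proj_perp_def)
    moreover have "hom j i j X Y = 0" "hom i j i Y X = 0" using True by (simp_all add: witt_tensor_hom_def)
    moreover have "conn X Y - conn Y X = P i ?L" using conn_diagonal X Y ij True by simp
    ultimately show ?thesis
      unfolding torsion_def tensors by (simp add: algebra_simps)
  next
    case False
    have "(\<Sum>k\<in>I. P k ?L) = P i ?L + (P j ?L + proj_perp I V i j ?L)"
      using sum.remove[OF finite_I ij(1), of "\<lambda>k. P k ?L"]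
        sum.remove[of "I - {i}" j "\<lambda>k. P k ?L"] False ij
      by (simp add: proj_perp_def Diff_insert2 [symmetric] insert_commute)
    then have "?L = P i ?L + (P j ?L + proj_perp I V i j ?L)"
      using sum_proj[OF L] by simp
    moreover have "conn X Y = P j ?L + hom j i j X Y"
      using conn_off_diagonal[OF X Y ij False] .
    moreover have "conn Y X = - P i ?L + hom i j i Y X"
      using conn_off_diagonal[OF Y X ij(2,1)] False lie_bracket_commute[of Y X] L ij
      by (simp add: proj_uminus)
    moreover have "u - v - l = - r + a - b" if "l = q' + (p' + r)" "u = p' + a" "v = - q' + b"
      for u v l r a b p' q' :: "'m field"
      using that by simp
    ultimately show ?thesis
      unfolding torsion_def tensors by blast
  qed
qed

section \<open>Metric connections are determined by their torsion\<close>

lemma affine_connection_sum: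
  assumes D: "affine_connection A D" and Y: "Y \<in> vector_fields A"
    and F: "\<And>a. a \<in> N \<Longrightarrow> F a \<in> vector_fields A"
  shows "D (\<Sum>a\<in>N. F a) Y = (\<Sum>a\<in>N. D (F a) Y)" "D Y (\<Sum>a\<in>N. F a) = (\<Sum>a\<in>N. D Y (F a))"
proof -
  have add: "D (X + Y) Z = D X Z + D Y Z" "D X (Y + Z) = D X Y + D X Z"
    if "X \<in> vector_fields A" "Y \<in> vector_fields A" "Z \<in> vector_fields A" for X Y Z
    using D that unfolding affine_connection_def by blast+
  have zero: "D 0 Y = 0" "D Y 0 = 0" using add(1)[of 0 0 Y] add(2)[of Y 0 0] Y by simp_all
  show "D (\<Sum>a\<in>N. F a) Y = (\<Sum>a\<in>N. D (F a) Y)" "D Y (\<Sum>a\<in>N. F a) = (\<Sum>a\<in>N. D Y (F a))"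
    using F by (induction N rule: infinite_finite_induct) (simp_all add: zero add Y)
qed

text \<open>The difference \<open>S\<close> of the two connections is biadditive, symmetric since the torsions agree, and
  skew for \<open>g\<close> since both are metric. Alternating the two symmetries three times shows that
  \<open>gf (S X Y) Z\<close> is its own negative.\<close>

lemma metric_connection_unique:
  assumes D: "affine_connection A D" "metric_connection A g D"
    and D': "affine_connection A D'" "metric_connection A g D'"
    and tors: "\<And>i j X Y. i \<in> I \<Longrightarrow> j \<in> I \<Longrightarrow> X \<in> sections A (V i) \<Longrightarrow> Y \<in> sections A (V j) \<Longrightarrow>
      torsion D X Y = torsion D' X Y"
  shows "D = D'"
proof -
  have ext: "D \<in> vector_fields A \<rightarrow>\<^sub>E vector_fields A \<rightarrow>\<^sub>E vector_fields A"
    "D' \<in> vector_fields A \<rightarrow>\<^sub>E vector_fields A \<rightarrow>\<^sub>E vector_fields A"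
    using D(1) D'(1) unfolding affine_connection_def by blast+
  have closed: "D X Y \<in> vector_fields A" "D' X Y \<in> vector_fields A"
    if "X \<in> vector_fields A" "Y \<in> vector_fields A" for X Y
    using PiE_mem[OF PiE_mem[OF ext(1)]] PiE_mem[OF PiE_mem[OF ext(2)]] that by blast+
  define S where "S X Y = D X Y - D' X Y" for X Y
  have S_closed: "S X Y \<in> vector_fields A" if "X \<in> vector_fields A" "Y \<in> vector_fields A" for X Y
    using closed that by (simp add: S_def)
  have split: "S X Y = (\<Sum>i\<in>I. \<Sum>j\<in>I. S (P i X) (P j Y))"
    if X: "X \<in> vector_fields A" and Y: "Y \<in> vector_fields A" for X Y
  proof -
    have *: "E X Y = (\<Sum>i\<in>I. \<Sum>j\<in>I. E (P i X) (P j Y))" if E: "affine_connection A E" for E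
    proof -
      have "E X Y = (\<Sum>i\<in>I. E (P i X) Y)"
        using affine_connection_sum(1)[OF E Y, of I "\<lambda>i. P i X"] sum_proj[OF X] X by simp
      also have "\<dots> = (\<Sum>i\<in>I. \<Sum>j\<in>I. E (P i X) (P j Y))"
      proof (rule sum.cong[OF refl])
        fix i assume "i \<in> I"
        then show "E (P i X) Y = (\<Sum>j\<in>I. E (P i X) (P j Y))"
          using affine_connection_sum(2)[OF E, of "P i X" I "\<lambda>j. P j Y"] sum_proj[OF Y] X Y by simp
      qed
      finally show ?thesis .
    qed
    show ?thesis unfolding S_def sum_subtractf using *[OF D(1)] *[OF D'(1)] by simp
  qed
  have S_sym: "S X Y = S Y X" if X: "X \<in> vector_fields A" and Y: "Y \<in> vector_fields A" for X Y
  proof -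
    have "S (P i X) (P j Y) = S (P j Y) (P i X)" if "i \<in> I" "j \<in> I" for i j
      using tors[OF that proj_section[OF X that(1)] proj_section[OF Y that(2)]]
      by (simp add: S_def torsion_def algebra_simps)
    then have "S X Y = (\<Sum>i\<in>I. \<Sum>j\<in>I. S (P j Y) (P i X))" using split[OF X Y] by simp
    also have "\<dots> = S Y X" unfolding split[OF Y X] by (rule sum.swap)
    finally show ?thesis .
  qed
  have S_skew: "gf (S X Y) Z = - gf (S X Z) Y"
    if "X \<in> vector_fields A" "Y \<in> vector_fields A" "Z \<in> vector_fields A" for X Y Z
  proof -
    have "gf (D X Y) Z + gf Y (D X Z) = gf (D' X Y) Z + gf Y (D' X Z)"
      using D(2) D'(2) that unfolding metric_connection_def by metis
    then show ?thesis
      using closed that gf_commute[of Y "D X Z"] gf_commute[of Y "D' X Z"]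
      by (simp add: S_def gf_diff_left algebra_simps)
  qed
  have "S X Y = 0" if X: "X \<in> vector_fields A" and Y: "Y \<in> vector_fields A" for X Y
  proof (rule metric_fun_separates[OF S_closed[OF X Y]])
    fix Z assume Z: "Z \<in> vector_fields A"
    have "gf (S X Y) Z = - gf (S Z X) Y" using S_skew[OF X Y Z] S_sym[OF X Z] by simp
    also have "\<dots> = gf (S Y Z) X" using S_skew[OF Z X Y] S_sym[OF Z Y] by simp
    also have "\<dots> = - gf (S X Y) Z" using S_skew[OF Y Z X] S_sym[OF X Y] by simp
    finally show "gf (S X Y) Z = 0" by (simp add: fun_eq_iff)
  qed
  then have eq: "D X Y = D' X Y" if "X \<in> vector_fields A" "Y \<in> vector_fields A" for X Y
    using that by (simp add: S_def)
  show ?thesis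
  proof (rule PiE_ext[OF ext])
    fix X assume X: "X \<in> vector_fields A"
    show "D X = D' X"
      by (rule PiE_ext[OF PiE_mem[OF ext(1) X] PiE_mem[OF ext(2) X]]) (rule eq[OF X])
  qed
qed

theorem canonical_connection:
  "\<exists>!D. witt_connection A g I V D \<and>
    (\<forall>i\<in>I. \<forall>j\<in>I. \<forall>X\<in>sections A (V i). \<forall>Y\<in>sections A (V j).
      torsion D X Y = - proj_perp I V i j (lie_bracket X Y)
        + witt_tensor A g I d V j X Y - witt_tensor A g I d V i Y X)"
proof (rule ex1I)
  show "witt_connection A g I V conn \<and> (\<forall>i\<in>I. \<forall>j\<in>I. \<forall>X\<in>sections A (V i). \<forall>Y\<in>sections A (V j).
      torsion conn X Y = - proj_perp I V i j (lie_bracket X Y)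
        + witt_tensor A g I d V j X Y - witt_tensor A g I d V i Y X)"
    using witt_connection_conn torsion_conn by simp
next
  fix D assume D: "witt_connection A g I V D \<and>
    (\<forall>i\<in>I. \<forall>j\<in>I. \<forall>X\<in>sections A (V i). \<forall>Y\<in>sections A (V j).
      torsion D X Y = - proj_perp I V i j (lie_bracket X Y)
        + witt_tensor A g I d V j X Y - witt_tensor A g I d V i Y X)"
  show "D = conn"
  proof (rule metric_connection_unique)
    show "affine_connection A D" "metric_connection A g D"
      using D unfolding witt_connection_def by simp_all
    show "torsion D X Y = torsion conn X Y"
      if "i \<in> I" "j \<in> I" "X \<in> sections A (V i)" "Y \<in> sections A (V j)" for i j X Y
      using D torsion_conn[OF that(3,4,1,2)] that by simp
  qed (rule affine_connection_conn metric_connection_conn)+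
qed

end

section \<open>Witt structures\<close>

lemma witt_labels_distinct:
  assumes "witt_labels r s q p p'"
  shows "inj_on p {1..s}" "inj_on p' {1..s}"
    and "\<And>k m. k \<in> {1..s} \<Longrightarrow> m \<in> {1..s} \<Longrightarrow> p k \<noteq> p' m"
    and "\<And>l k. l \<in> {1..r} \<Longrightarrow> k \<in> {1..s} \<Longrightarrow> q l \<noteq> p k \<and> q l \<noteq> p' k"
proof -
  have set: "set [1..<Suc s] = {1..s}" "set [1..<Suc r] = {1..r}" by auto
  have "distinct (map q [1..<Suc r] @ map p [1..<Suc s] @ map p' [1..<Suc s])"
    using assms by (simp only: witt_labels_def)
  then have *: "inj_on p {1..s} \<and> inj_on p' {1..s} \<and> p ` {1..s} \<inter> p' ` {1..s} = {} \<and>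
      q ` {1..r} \<inter> (p ` {1..s} \<union> p' ` {1..s}) = {}"
    unfolding distinct_append distinct_map set_append set_map set by blast
  then show "inj_on p {1..s}" "inj_on p' {1..s}" by simp_all
  show "p k \<noteq> p' m" if "k \<in> {1..s}" "m \<in> {1..s}" for k m
    using * imageI[OF that(1), of p] imageI[OF that(2), of p'] by (metis disjoint_iff)
  show "q l \<noteq> p k \<and> q l \<noteq> p' k" if "l \<in> {1..r}" "k \<in> {1..s}" for l k
    using * imageI[OF that(1), of q] imageI[OF that(2), of p] imageI[OF that(2), of p']
    by (metis UnCI disjoint_iff)
qed

lemma witt_dual_simps:
  assumes "witt_labels r s q p p'"
  shows "k \<in> {1..s} \<Longrightarrow> witt_dual s p p' (p k) = p' k"
    and "k \<in> {1..s} \<Longrightarrow> witt_dual s p p' (p' k) = p k"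
    and "l \<in> {1..r} \<Longrightarrow> witt_dual s p p' (q l) = q l"
proof -
  note L = witt_labels_distinct[OF assms]
  show "witt_dual s p p' (p k) = p' k" if "k \<in> {1..s}"
    unfolding witt_dual_def using that the_inv_into_f_f[OF L(1) that] by simp
  have "p' k \<notin> p ` {1..s}" if "k \<in> {1..s}" using L(3)[OF _ that] by force
  then show "witt_dual s p p' (p' k) = p k" if "k \<in> {1..s}"
    unfolding witt_dual_def using that the_inv_into_f_f[OF L(2) that] by simp
  have "q l \<notin> p ` {1..s}" "q l \<notin> p' ` {1..s}" if "l \<in> {1..r}" using L(4)[OF that] by force+
  then show "witt_dual s p p' (q l) = q l" if "l \<in> {1..r}"
    unfolding witt_dual_def using that by simp
qed

lemma witt_index_cases:
  assumes "i \<in> witt_index_set r s q p p'"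
  obtains l where "l \<in> {1..r}" "i = q l" | k where "k \<in> {1..s}" "i = p k"
    | k where "k \<in> {1..s}" "i = p' k"
  using assms unfolding witt_index_set_def by blast

lemma witt_block_of:
  assumes "i \<in> witt_index_set r s q p p'"
  obtains B where "B \<in> witt_blocks r s q p p'" "i \<in> B"
  using assms
proof (cases rule: witt_index_cases)
  case (1 l)
  then show ?thesis using that[of "{q l}"] unfolding witt_blocks_def by blast
next
  case (2 k)
  then show ?thesis using that[of "{p k, p' k}"] unfolding witt_blocks_def by blast
next
  case (3 k)
  then show ?thesis using that[of "{p k, p' k}"] unfolding witt_blocks_def by blast
qed

lemma witt_structureD:
  assumes "witt_structure A g r s q p p' V"
  shows "witt_labels r s q p p'"
    and "\<forall>i\<in>witt_index_set r s q p p'. \<exists>n. subbundle A n (V i)"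
    and "\<forall>x. \<forall>v\<in>tangent_space A x. \<exists>!u. is_decomp (witt_index_set r s q p p') (\<lambda>i. V i x) v u"
    and "\<forall>B\<in>witt_blocks r s q p p'. \<forall>B'\<in>witt_blocks r s q p p'. B \<noteq> B' \<longrightarrow>
       (\<forall>i\<in>B. \<forall>j\<in>B'. \<forall>x. \<forall>v\<in>V i x. \<forall>w\<in>V j x. g x v w = 0)"
    and "\<forall>k\<in>{1..s}. (\<forall>x. \<forall>v\<in>V (p k) x. \<forall>w\<in>V (p k) x. g x v w = 0) \<and>
       (\<forall>x. \<forall>v\<in>V (p' k) x. \<forall>w\<in>V (p' k) x. g x v w = 0)"
  using assms unfolding witt_structure_def by simp_all

text \<open>Distinct blocks are orthogonal, and inside a block \<open>{p k, p' k}\<close> the two subbundles are totally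
  isotropic; in a block \<open>{q l}\<close> there is nothing to show.\<close>

lemma witt_orthogonal:
  assumes W: "witt_structure A g r s q p p' V"
    and i: "i \<in> witt_index_set r s q p p'" and j: "j \<in> witt_index_set r s q p p'"
    and ji: "j \<noteq> witt_dual s p p' i" and v: "v \<in> V i x" and w: "w \<in> V j x"
  shows "g x v w = 0"
proof -
  note W' = witt_structureD[OF W]
  note dual = witt_dual_simps[OF W'(1)]
  have blocks: "g x v w = 0" if "B \<in> witt_blocks r s q p p'" "i \<in> B" "j \<notin> B" for B
  proof -
    obtain B' where "B' \<in> witt_blocks r s q p p'" "j \<in> B'" using j by (rule witt_block_of)
    then show ?thesis using W'(4) that v w by metis
  qed
  show ?thesis
    using i
  proof (cases rule: witt_index_cases)
    case (1 l)
    have "{q l} \<in> witt_blocks r s q p p'" using 1 unfolding witt_blocks_def by blast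
    then show ?thesis using blocks[of "{q l}"] 1 ji dual(3) by simp
  next
    case (2 k)
    have "{p k, p' k} \<in> witt_blocks r s q p p'" using 2 unfolding witt_blocks_def by blast
    moreover have "g x v w = 0" if "j = p k"
      using W'(5) 2 that v w by blast
    ultimately show ?thesis using blocks[of "{p k, p' k}"] 2 ji dual(1) by auto
  next
    case (3 k)
    have "{p k, p' k} \<in> witt_blocks r s q p p'" using 3 unfolding witt_blocks_def by blast
    moreover have "g x v w = 0" if "j = p' k"
      using W'(5) 3 that v w by blast
    ultimately show ?thesis using blocks[of "{p k, p' k}"] 3 ji dual(2) by auto
  qed
qed

theorem proposition3p1:
  fixes A :: "('m::{t2_space,second_countable_topology}, 'e::euclidean_space) atlas"
    and g :: "'m metric"
    and r s :: nat
    and q p p' :: "nat \<Rightarrow> int"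
    and V :: "int \<Rightarrow> 'm \<Rightarrow> 'm tangent set"
  assumes "smooth_manifold A"
    and "pseudo_riemannian_metric A g"
    and "witt_structure A g r s q p p' V"
  shows "let I = witt_index_set r s q p p'; d = witt_dual s p p' in
    \<exists>!D. witt_connection A g I V D \<and>
      (\<forall>i\<in>I. \<forall>j\<in>I. \<forall>X\<in>sections A (V i). \<forall>Y\<in>sections A (V j).
        torsion D X Y =
          - proj_perp I V i j (lie_bracket X Y)
          + witt_tensor A g I d V j X Y - witt_tensor A g I d V i Y X)"
proof -
  note W = witt_structureD[OF assms(3)]
  note dual = witt_dual_simps[OF W(1)]
  let ?I = "witt_index_set r s q p p'" and ?d = "witt_dual s p p'"
  have "?d i \<in> ?I \<and> ?d (?d i) = i" if "i \<in> ?I" for i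
    using that
  proof (cases rule: witt_index_cases)
    case (1 l)
    then show ?thesis using dual(3) that by simp
  next
    case (2 k)
    then show ?thesis using dual(1,2) by (simp add: witt_index_set_def)
  next
    case (3 k)
    then show ?thesis using dual(1,2) by (simp add: witt_index_set_def)
  qed
  moreover have "finite ?I" by (simp add: witt_index_set_def)
  ultimately interpret dual_splitting A g ?I ?d V
    using assms(1,2) W(2,3) witt_orthogonal[OF assms(3)]
    by unfold_locales blast+
  show ?thesis
    unfolding Let_def by (rule canonical_connection)
qed

end
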